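(* Let $\mathbb{P}$ be a prop, let $\mathcal{C}$ be a symmetric monoidal category, and let $s$ be a supply of $\mathbb{P}$ in $\mathcal{C}$. Then all the coherence isomorphisms in $\mathcal{C}$, namely every associator $(a\otimes b)\otimes c\to a\otimes(b\otimes c)$, every left and right unitor $I\otimes a\to a$, $a\otimes I\to a$, and every braiding $a\otimes b\to b\otimes a$ (for objects $a,b,c$ of $\mathcal{C}$), are $s$-homomorphisms.
   Context: Strong monoidal functors between symmetric monoidal categories are always understood to be symmetric; their structure isomorphisms are called strongators. In a symmetric monoidal category $(\mathcal{C},I,\otimes)$, write $b^{\otimes m}$ for the left-bracketed $m$-fold product $((b\otimes b)\otimes\cdots)\otimes b$, with $b^{\otimes 0}=I$ and $b^{\otimes 1}=b$. Write $\sigma\colon c^{\otimes n}\otimes d^{\otimes n}\to(c\otimes d)^{\otimes n}$ and $\sigma\colon I\to I^{\otimes n}$ for the canonical (Mac Lane coherence) isomorphisms, the first one realizing the evident shuffle permutation. A prop is a symmetric strict monoidal category whose monoid of objects is $(\mathbb{N},0,+)$. A supply $s$ of a prop $\mathbb{P}$ in $\mathcal{C}$ consists of a strong monoidal functor $s_c\colon\mathbb{P}\to\mathcal{C}$ for each object $c\in\mathcal{C}$ such that: (i) $s_c(m)=c^{\otimes m}$ for each $m\in\mathbb{N}$; (ii) the strongator $c^{\otimes m}\otimes c^{\otimes n}\to c^{\otimes(m+n)}$ is the unique coherence (rebracketing) isomorphism for each $m,n$; (iii) for all $c,d\in\mathcal{C}$ and $\mu\colon m\to n$ in $\mathbb{P}$,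 $s_{c\otimes d}(\mu)\circ\sigma=\sigma\circ(s_c(\mu)\otimes s_d(\mu))$ as maps $c^{\otimes m}\otimes d^{\otimes m}\to(c\otimes d)^{\otimes n}$, and $s_I(\mu)\circ\sigma=\sigma$ as maps $I\to I^{\otimes n}$. A morphism $f\colon c\to d$ in $\mathcal{C}$ is an $s$-homomorphism if $f^{\otimes n}\circ s_c(\mu)=s_d(\mu)\circ f^{\otimes m}$ for every $\mu\colon m\to n$ in $\mathbb{P}$. *)

theory Defs
  imports Main
begin

section \<open>Symmetric monoidal categories\<close>

record ('o, 'm) smc =
  Obj :: "'o set"
  Arr :: "'m set"
  Dom :: "'m \<Rightarrow> 'o"
  Cod :: "'m \<Rightarrow> 'o"
  Ident :: "'o \<Rightarrow> 'm"
  Comp :: "'m \<Rightarrow> 'm \<Rightarrow> 'm"  (infixl \<open>\<cdot>\<index>\<close> 65)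
  TensO :: "'o \<Rightarrow> 'o \<Rightarrow> 'o"  (infixl \<open>\<otimes>\<index>\<close> 70)
  TensA :: "'m \<Rightarrow> 'm \<Rightarrow> 'm"  (infixl \<open>\<boxtimes>\<index>\<close> 70)
  UnitO :: "'o"
  Assoc :: "'o \<Rightarrow> 'o \<Rightarrow> 'o \<Rightarrow> 'm"
  LUnit :: "'o \<Rightarrow> 'm"
  RUnit :: "'o \<Rightarrow> 'm"
  Braid :: "'o \<Rightarrow> 'o \<Rightarrow> 'm"

definition Hom :: "('o, 'm, 'z) smc_scheme \<Rightarrow> 'o \<Rightarrow> 'o \<Rightarrow> 'm set" where
  "Hom C a b = {f \<in> Arr C. Dom C f = a \<and> Cod C f = b}"

definition inverse_arrows :: "('o, 'm, 'z) smc_scheme \<Rightarrow> 'm \<Rightarrow> 'm \<Rightarrow> bool" where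
  "inverse_arrows C f g \<longleftrightarrow>
     f \<in> Arr C \<and> g \<in> Hom C (Cod C f) (Dom C f) \<and>
     g \<cdot>\<^bsub>C\<^esub> f = Ident C (Dom C f) \<and> f \<cdot>\<^bsub>C\<^esub> g = Ident C (Cod C f)"

definition iso_arrow :: "('o, 'm, 'z) smc_scheme \<Rightarrow> 'm \<Rightarrow> bool" where
  "iso_arrow C f \<longleftrightarrow> (\<exists>g. inverse_arrows C f g)"

locale symmetric_monoidal_category =
  fixes C :: "('o, 'm, 'z) smc_scheme" (structure)
  assumes dom_obj: "f \<in> Arr C \<Longrightarrow> Dom C f \<in> Obj C"
    and cod_obj: "f \<in> Arr C \<Longrightarrow> Cod C f \<in> Obj C"
    and ident_hom: "a \<in> Obj C \<Longrightarrow> Ident C a \<in> Hom C a a"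
    and comp_hom: "\<lbrakk>g \<in> Hom C b c; f \<in> Hom C a b\<rbrakk> \<Longrightarrow> g \<cdot> f \<in> Hom C a c"
    and comp_ident_left: "f \<in> Hom C a b \<Longrightarrow> Ident C b \<cdot> f = f"
    and comp_ident_right: "f \<in> Hom C a b \<Longrightarrow> f \<cdot> Ident C a = f"
    and comp_assoc: "\<lbrakk>h \<in> Hom C c d; g \<in> Hom C b c; f \<in> Hom C a b\<rbrakk>
          \<Longrightarrow> (h \<cdot> g) \<cdot> f = h \<cdot> (g \<cdot> f)"
    and unit_obj: "UnitO C \<in> Obj C"
    and tens_obj: "\<lbrakk>a \<in> Obj C; b \<in> Obj C\<rbrakk> \<Longrightarrow> a \<otimes> b \<in> Obj C"
    and tens_hom: "\<lbrakk>f \<in> Hom C a b; g \<in> Hom C c d\<rbrakk> \<Longrightarrow> f \<boxtimes> g \<in> Hom C (a \<otimes> c) (b \<otimes> d)"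
    and tens_ident: "\<lbrakk>a \<in> Obj C; b \<in> Obj C\<rbrakk>
          \<Longrightarrow> Ident C a \<boxtimes> Ident C b = Ident C (a \<otimes> b)"
    and tens_comp: "\<lbrakk>g \<in> Hom C b c; f \<in> Hom C a b; g' \<in> Hom C b' c'; f' \<in> Hom C a' b'\<rbrakk>
          \<Longrightarrow> (g \<cdot> f) \<boxtimes> (g' \<cdot> f') = (g \<boxtimes> g') \<cdot> (f \<boxtimes> f')"
    and assoc_hom: "\<lbrakk>a \<in> Obj C; b \<in> Obj C; c \<in> Obj C\<rbrakk>
          \<Longrightarrow> Assoc C a b c \<in> Hom C ((a \<otimes> b) \<otimes> c) (a \<otimes> (b \<otimes> c))"
    and assoc_iso: "\<lbrakk>a \<in> Obj C; b \<in> Obj C; c \<in> Obj C\<rbrakk> \<Longrightarrow> iso_arrow C (Assoc C a b c)"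
    and assoc_natural: "\<lbrakk>f \<in> Hom C a a'; g \<in> Hom C b b'; h \<in> Hom C c c'\<rbrakk>
          \<Longrightarrow> Assoc C a' b' c' \<cdot> ((f \<boxtimes> g) \<boxtimes> h) = (f \<boxtimes> (g \<boxtimes> h)) \<cdot> Assoc C a b c"
    and lunit_hom: "a \<in> Obj C \<Longrightarrow> LUnit C a \<in> Hom C (UnitO C \<otimes> a) a"
    and lunit_iso: "a \<in> Obj C \<Longrightarrow> iso_arrow C (LUnit C a)"
    and lunit_natural: "f \<in> Hom C a b
          \<Longrightarrow> LUnit C b \<cdot> (Ident C (UnitO C) \<boxtimes> f) = f \<cdot> LUnit C a"
    and runit_hom: "a \<in> Obj C \<Longrightarrow> RUnit C a \<in> Hom C (a \<otimes> UnitO C) a"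
    and runit_iso: "a \<in> Obj C \<Longrightarrow> iso_arrow C (RUnit C a)"
    and runit_natural: "f \<in> Hom C a b
          \<Longrightarrow> RUnit C b \<cdot> (f \<boxtimes> Ident C (UnitO C)) = f \<cdot> RUnit C a"
    and pentagon: "\<lbrakk>a \<in> Obj C; b \<in> Obj C; c \<in> Obj C; d \<in> Obj C\<rbrakk>
          \<Longrightarrow> Assoc C a b (c \<otimes> d) \<cdot> Assoc C (a \<otimes> b) c d =
              (Ident C a \<boxtimes> Assoc C b c d) \<cdot> Assoc C a (b \<otimes> c) d \<cdot> (Assoc C a b c \<boxtimes> Ident C d)"
    and triangle: "\<lbrakk>a \<in> Obj C; b \<in> Obj C\<rbrakk>
          \<Longrightarrow> (Ident C a \<boxtimes> LUnit C b) \<cdot> Assoc C a (UnitO C) b = RUnit C a \<boxtimes> Ident C b"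
    and braid_hom: "\<lbrakk>a \<in> Obj C; b \<in> Obj C\<rbrakk> \<Longrightarrow> Braid C a b \<in> Hom C (a \<otimes> b) (b \<otimes> a)"
    and braid_natural: "\<lbrakk>f \<in> Hom C a a'; g \<in> Hom C b b'\<rbrakk>
          \<Longrightarrow> Braid C a' b' \<cdot> (f \<boxtimes> g) = (g \<boxtimes> f) \<cdot> Braid C a b"
    and braid_symmetric: "\<lbrakk>a \<in> Obj C; b \<in> Obj C\<rbrakk>
          \<Longrightarrow> Braid C b a \<cdot> Braid C a b = Ident C (a \<otimes> b)"
    and hexagon: "\<lbrakk>a \<in> Obj C; b \<in> Obj C; c \<in> Obj C\<rbrakk>
          \<Longrightarrow> Assoc C b c a \<cdot> Braid C a (b \<otimes> c) \<cdot> Assoc C a b c =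
              (Ident C b \<boxtimes> Braid C a c) \<cdot> Assoc C b a c \<cdot> (Braid C a b \<boxtimes> Ident C c)"


section \<open>Props\<close>

text \<open>The last three assumptions are strictness; associativity and unitality of the tensor
  product on objects are automatic, since it is addition.\<close>

locale prop_category = symmetric_monoidal_category P
  for P :: "(nat, 'p, 'y) smc_scheme" +
  assumes obj_nat: "Obj P = UNIV"
    and unit_zero: "UnitO P = 0"
    and tens_add: "TensO P m n = m + n"
    and assoc_strict: "Assoc P k m n = Ident P (k + m + n)"
    and lunit_strict: "LUnit P n = Ident P n"
    and runit_strict: "RUnit P n = Ident P n"


section \<open>Strong symmetric monoidal functors\<close>

record ('o1, 'm1, 'o2, 'm2) monfun =
  FObj :: "'o1 \<Rightarrow> 'o2"
  FArr :: "'m1 \<Rightarrow> 'm2"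
  Strongator :: "'o1 \<Rightarrow> 'o1 \<Rightarrow> 'm2"
  UStrongator :: "'m2"

locale strong_monoidal_functor =
  A: symmetric_monoidal_category A + B: symmetric_monoidal_category B
  for A :: "('o1, 'm1, 'z1) smc_scheme" and B :: "('o2, 'm2, 'z2) smc_scheme" +
  fixes F :: "('o1, 'm1, 'o2, 'm2, 'z3) monfun_scheme"
  assumes fobj: "a \<in> Obj A \<Longrightarrow> FObj F a \<in> Obj B"
    and farr: "f \<in> Hom A a b \<Longrightarrow> FArr F f \<in> Hom B (FObj F a) (FObj F b)"
    and farr_ident: "a \<in> Obj A \<Longrightarrow> FArr F (Ident A a) = Ident B (FObj F a)"
    and farr_comp: "\<lbrakk>g \<in> Hom A b c; f \<in> Hom A a b\<rbrakk>
          \<Longrightarrow> FArr F (g \<cdot>\<^bsub>A\<^esub> f) = FArr F g \<cdot>\<^bsub>B\<^esub> FArr F f"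
    and strongator_hom: "\<lbrakk>a \<in> Obj A; b \<in> Obj A\<rbrakk>
          \<Longrightarrow> Strongator F a b \<in> Hom B (FObj F a \<otimes>\<^bsub>B\<^esub> FObj F b) (FObj F (a \<otimes>\<^bsub>A\<^esub> b))"
    and strongator_iso: "\<lbrakk>a \<in> Obj A; b \<in> Obj A\<rbrakk> \<Longrightarrow> iso_arrow B (Strongator F a b)"
    and strongator_natural: "\<lbrakk>f \<in> Hom A a a'; g \<in> Hom A b b'\<rbrakk>
          \<Longrightarrow> Strongator F a' b' \<cdot>\<^bsub>B\<^esub> (FArr F f \<boxtimes>\<^bsub>B\<^esub> FArr F g) =
              FArr F (f \<boxtimes>\<^bsub>A\<^esub> g) \<cdot>\<^bsub>B\<^esub> Strongator F a b"
    and ustrongator_hom: "UStrongator F \<in> Hom B (UnitO B) (FObj F (UnitO A))"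
    and ustrongator_iso: "iso_arrow B (UStrongator F)"
    and strongator_assoc: "\<lbrakk>a \<in> Obj A; b \<in> Obj A; c \<in> Obj A\<rbrakk>
          \<Longrightarrow> FArr F (Assoc A a b c) \<cdot>\<^bsub>B\<^esub> Strongator F (a \<otimes>\<^bsub>A\<^esub> b) c
                \<cdot>\<^bsub>B\<^esub> (Strongator F a b \<boxtimes>\<^bsub>B\<^esub> Ident B (FObj F c)) =
              Strongator F a (b \<otimes>\<^bsub>A\<^esub> c) \<cdot>\<^bsub>B\<^esub> (Ident B (FObj F a) \<boxtimes>\<^bsub>B\<^esub> Strongator F b c)
                \<cdot>\<^bsub>B\<^esub> Assoc B (FObj F a) (FObj F b) (FObj F c)"
    and strongator_lunit: "a \<in> Obj A
          \<Longrightarrow> FArr F (LUnit A a) \<cdot>\<^bsub>B\<^esub> Strongator F (UnitO A) a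
                \<cdot>\<^bsub>B\<^esub> (UStrongator F \<boxtimes>\<^bsub>B\<^esub> Ident B (FObj F a)) = LUnit B (FObj F a)"
    and strongator_runit: "a \<in> Obj A
          \<Longrightarrow> FArr F (RUnit A a) \<cdot>\<^bsub>B\<^esub> Strongator F a (UnitO A)
                \<cdot>\<^bsub>B\<^esub> (Ident B (FObj F a) \<boxtimes>\<^bsub>B\<^esub> UStrongator F) = RUnit B (FObj F a)"
    and strongator_braid: "\<lbrakk>a \<in> Obj A; b \<in> Obj A\<rbrakk>
          \<Longrightarrow> FArr F (Braid A a b) \<cdot>\<^bsub>B\<^esub> Strongator F a b =
              Strongator F b a \<cdot>\<^bsub>B\<^esub> Braid B (FObj F a) (FObj F b)"


section \<open>Left-bracketed products\<close>

fun lprod :: "('a \<Rightarrow> 'a \<Rightarrow> 'a) \<Rightarrow> 'a \<Rightarrow> (nat \<Rightarrow> 'a) \<Rightarrow> nat \<Rightarrow> 'a" where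
  "lprod t u x 0 = u"
| "lprod t u x (Suc 0) = x 0"
| "lprod t u x (Suc (Suc n)) = t (lprod t u x (Suc n)) (x (Suc n))"

definition opow :: "('o, 'm, 'z) smc_scheme \<Rightarrow> 'o \<Rightarrow> nat \<Rightarrow> 'o" where
  "opow C c n = lprod (TensO C) (UnitO C) (\<lambda>_. c) n"

definition apow :: "('o, 'm, 'z) smc_scheme \<Rightarrow> 'm \<Rightarrow> nat \<Rightarrow> 'm" where
  "apow C f n = lprod (TensA C) (Ident C (UnitO C)) (\<lambda>_. f) n"


section \<open>Coherence isomorphisms\<close>

datatype 'x word = Var 'x | One | Tens "'x word" "'x word"

primrec wobj :: "('o, 'm, 'z) smc_scheme \<Rightarrow> ('x \<Rightarrow> 'o) \<Rightarrow> 'x word \<Rightarrow> 'o" where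
  "wobj C v (Var x) = v x"
| "wobj C v One = UnitO C"
| "wobj C v (Tens X Y) = wobj C v X \<otimes>\<^bsub>C\<^esub> wobj C v Y"

text \<open>\<open>coherence C br v X Y f\<close>: the arrow \<open>f\<close> is the value, under the assignment \<open>v\<close> of objects to
  letters, of a formal composite \<open>X \<rightarrow> Y\<close> of associators, unitors, braidings and their inverses;
  braidings are admitted only if \<open>br\<close> holds. Composability is that of the formal words and not of
  their values. Hence, if every letter occurs exactly once in \<open>X\<close> and in \<open>Y\<close>, the permutation
  realized is determined by \<open>X\<close> and \<open>Y\<close>, and by Mac Lane's coherence theorem so is \<open>f\<close>;
  without braidings \<open>f\<close> is always determined.\<close>

inductive coherence ::
  "('o, 'm, 'z) smc_scheme \<Rightarrow> bool \<Rightarrow> ('x \<Rightarrow> 'o) \<Rightarrow> 'x word \<Rightarrow> 'x word \<Rightarrow> 'm \<Rightarrow> bool"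
  for C br v where
  coh_ident: "coherence C br v X X (Ident C (wobj C v X))"
| coh_comp: "\<lbrakk>coherence C br v Y Z g; coherence C br v X Y f\<rbrakk> \<Longrightarrow> coherence C br v X Z (g \<cdot>\<^bsub>C\<^esub> f)"
| coh_tens: "\<lbrakk>coherence C br v X Y f; coherence C br v X' Y' f'\<rbrakk>
    \<Longrightarrow> coherence C br v (Tens X X') (Tens Y Y') (f \<boxtimes>\<^bsub>C\<^esub> f')"
| coh_inverse: "\<lbrakk>coherence C br v X Y f; inverse_arrows C f g\<rbrakk> \<Longrightarrow> coherence C br v Y X g"
| coh_assoc: "coherence C br v (Tens (Tens X Y) Z) (Tens X (Tens Y Z))
    (Assoc C (wobj C v X) (wobj C v Y) (wobj C v Z))"
| coh_lunit: "coherence C br v (Tens One X) X (LUnit C (wobj C v X))"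
| coh_runit: "coherence C br v (Tens X One) X (RUnit C (wobj C v X))"
| coh_braid: "br \<Longrightarrow> coherence C br v (Tens X Y) (Tens Y X) (Braid C (wobj C v X) (wobj C v Y))"

abbreviation wprod :: "(nat \<Rightarrow> 'x word) \<Rightarrow> nat \<Rightarrow> 'x word" where
  "wprod \<equiv> lprod Tens One"

definition rebracketing :: "('o, 'm, 'z) smc_scheme \<Rightarrow> 'o \<Rightarrow> nat \<Rightarrow> nat \<Rightarrow> 'm \<Rightarrow> bool" where
  "rebracketing C c m n f \<longleftrightarrow>
     coherence C False (\<lambda>_. c)
       (Tens (wprod Var m) (wprod (\<lambda>i. Var (m + i)) n)) (wprod Var (m + n)) f"

text \<open>The canonical isomorphism from \<open>n\<close>-th powers of \<open>c\<close> and \<open>d\<close> to the \<open>n\<close>-th power of their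
  product: the letters \<open>Inl i\<close> and \<open>Inr i\<close> are the \<open>i\<close>-th copies of \<open>c\<close> and of \<open>d\<close>.\<close>

definition shuffle :: "('o, 'm, 'z) smc_scheme \<Rightarrow> 'o \<Rightarrow> 'o \<Rightarrow> nat \<Rightarrow> 'm \<Rightarrow> bool" where
  "shuffle C c d n f \<longleftrightarrow>
     coherence C True (case_sum (\<lambda>_. c) (\<lambda>_. d))
       (Tens (wprod (\<lambda>i. Var (Inl i)) n) (wprod (\<lambda>i. Var (Inr i)) n))
       (wprod (\<lambda>i. Tens (Var (Inl i)) (Var (Inr i))) n) f"

definition unit_shuffle :: "('o, 'm, 'z) smc_scheme \<Rightarrow> nat \<Rightarrow> 'm \<Rightarrow> bool" where
  "unit_shuffle C n f \<longleftrightarrow>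
     coherence C False (\<lambda>_::unit. UnitO C) One (wprod (\<lambda>_. One) n) f"


section \<open>Supplies and homomorphisms\<close>

text \<open>Coherence isomorphisms are given by predicates, each satisfied by exactly one arrow (Mac Lane);
  the quantifiers over \<open>\<sigma>\<close> and \<open>\<tau>\<close> below therefore only name the canonical isomorphisms for the
  exponents \<open>m\<close> and \<open>n\<close>.\<close>

locale supply_in = P: prop_category P + C: symmetric_monoidal_category C
  for P :: "(nat, 'p, 'y) smc_scheme" and C :: "('o, 'm, 'z) smc_scheme" +
  fixes s :: "'o \<Rightarrow> (nat, 'p, 'o, 'm) monfun"
  assumes supply_functor: "c \<in> Obj C \<Longrightarrow> strong_monoidal_functor P C (s c)"
    and supply_obj: "c \<in> Obj C \<Longrightarrow> FObj (s c) m = opow C c m"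
    and supply_strongator: "c \<in> Obj C \<Longrightarrow> rebracketing C c m n (Strongator (s c) m n)"
    and supply_tens:
      "\<lbrakk>c \<in> Obj C; d \<in> Obj C; \<mu> \<in> Hom P m n; shuffle C c d m \<sigma>; shuffle C c d n \<tau>\<rbrakk>
        \<Longrightarrow> FArr (s (c \<otimes>\<^bsub>C\<^esub> d)) \<mu> \<cdot>\<^bsub>C\<^esub> \<sigma> = \<tau> \<cdot>\<^bsub>C\<^esub> (FArr (s c) \<mu> \<boxtimes>\<^bsub>C\<^esub> FArr (s d) \<mu>)"
    and supply_unit:
      "\<lbrakk>\<mu> \<in> Hom P m n; unit_shuffle C m \<sigma>; unit_shuffle C n \<tau>\<rbrakk>
        \<Longrightarrow> FArr (s (UnitO C)) \<mu> \<cdot>\<^bsub>C\<^esub> \<sigma> = \<tau>"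

definition supply_homomorphism ::
  "(nat, 'p, 'y) smc_scheme \<Rightarrow> ('o, 'm, 'z) smc_scheme \<Rightarrow> ('o \<Rightarrow> (nat, 'p, 'o, 'm) monfun) \<Rightarrow> 'm \<Rightarrow> bool"
  where
  "supply_homomorphism P C s f \<longleftrightarrow>
     f \<in> Arr C \<and>
     (\<forall>m n. \<forall>\<mu> \<in> Hom P m n.
        apow C f n \<cdot>\<^bsub>C\<^esub> FArr (s (Dom C f)) \<mu> = FArr (s (Cod C f)) \<mu> \<cdot>\<^bsub>C\<^esub> apow C f m)"

end

theory Submission
  imports Defs
begin

text \<open>Compatibility with the tensor product and the unit determines the supply on \<open>a \<otimes> b\<close> and on \<open>I\<close>
  by conjugation with the shuffles. So a coherence isomorphism \<open>f\<close> is a homomorphism as soon as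
  \<open>f\<^sup>\<otimes>\<^sup>n\<close> composed with the shuffles is the shuffles composed with \<open>f\<close> at \<open>n\<close>-th powers, and this
  follows by induction on \<open>n\<close> from one identity each for the middle-four interchange.
  These identities are instances of Mac Lane coherence. They are checked in a strict model: a word
  \<open>X\<close> acts on objects by \<open>z \<mapsto> x\<^sub>1 \<otimes> (x\<^sub>2 \<otimes> \<dots> \<otimes> z)\<close>, isomorphically to \<open>X \<otimes> z\<close>. Transported
  along this isomorphism, \<open>f \<otimes> z\<close> becomes an identity for associators and unitors, the hexagon makes
  braidings composites of elementary swaps, and \<open>z = I\<close> recovers \<open>f\<close>. The right unitor then comes
  for free, being the left unitor after a braiding.\<close>

context symmetric_monoidal_category
begin

section \<open>Typing rules and equational laws for the simplifier\<close>

lemma arr_simps [simp]: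
  "f \<in> Arr C \<Longrightarrow> Dom C f \<in> Obj C"
  "f \<in> Arr C \<Longrightarrow> Cod C f \<in> Obj C"
  "UnitO C \<in> Obj C"
  "\<lbrakk>a \<in> Obj C; b \<in> Obj C\<rbrakk> \<Longrightarrow> a \<otimes> b \<in> Obj C"
  by (simp_all add: dom_obj cod_obj unit_obj tens_obj)

text \<open>The axioms are phrased with \<open>Hom C a b\<close>, whose end objects would have to be
  guessed. Restated with \<open>Arr\<close>, \<open>Dom\<close> and \<open>Cod\<close>, here and
  below, composability is checked by rewriting.\<close>

lemma ident_simps [simp]:
  assumes "a \<in> Obj C"
  shows "Ident C a \<in> Arr C" "Dom C (Ident C a) = a" "Cod C (Ident C a) = a"
  using ident_hom[OF assms] by (auto simp: Hom_def)

lemma comp_simps [simp]: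
  assumes "f \<in> Arr C" "g \<in> Arr C" "Dom C g = Cod C f"
  shows "g \<cdot> f \<in> Arr C" "Dom C (g \<cdot> f) = Dom C f" "Cod C (g \<cdot> f) = Cod C g"
  using comp_hom[of g "Cod C f" "Cod C g" f "Dom C f"] assms by (auto simp: Hom_def)

lemma tens_simps [simp]:
  assumes "f \<in> Arr C" "g \<in> Arr C"
  shows "f \<boxtimes> g \<in> Arr C" "Dom C (f \<boxtimes> g) = Dom C f \<otimes> Dom C g" "Cod C (f \<boxtimes> g) = Cod C f \<otimes> Cod C g"
  using tens_hom[of f "Dom C f" "Cod C f" g "Dom C g" "Cod C g"] assms by (auto simp: Hom_def)

lemma assoc_simps [simp]:
  assumes "a \<in> Obj C" "b \<in> Obj C" "c \<in> Obj C"
  shows "Assoc C a b c \<in> Arr C" "Dom C (Assoc C a b c) = (a \<otimes> b) \<otimes> c"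
    "Cod C (Assoc C a b c) = a \<otimes> (b \<otimes> c)"
  using assoc_hom[OF assms] by (auto simp: Hom_def)

lemma unitor_simps [simp]:
  assumes "a \<in> Obj C"
  shows "LUnit C a \<in> Arr C" "Dom C (LUnit C a) = UnitO C \<otimes> a" "Cod C (LUnit C a) = a"
    "RUnit C a \<in> Arr C" "Dom C (RUnit C a) = a \<otimes> UnitO C" "Cod C (RUnit C a) = a"
  using lunit_hom[OF assms] runit_hom[OF assms] by (auto simp: Hom_def)

lemma braid_simps [simp]:
  assumes "a \<in> Obj C" "b \<in> Obj C"
  shows "Braid C a b \<in> Arr C" "Dom C (Braid C a b) = a \<otimes> b" "Cod C (Braid C a b) = b \<otimes> a"
  using braid_hom[OF assms] by (auto simp: Hom_def)

lemma ident_comp [simp]: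
  "\<lbrakk>f \<in> Arr C; Cod C f = b\<rbrakk> \<Longrightarrow> Ident C b \<cdot> f = f"
  "\<lbrakk>f \<in> Arr C; Dom C f = a\<rbrakk> \<Longrightarrow> f \<cdot> Ident C a = f"
  by (auto intro: comp_ident_left comp_ident_right simp: Hom_def)

lemma comp_assoc_arr [simp]:
  "\<lbrakk>f \<in> Arr C; g \<in> Arr C; h \<in> Arr C; Dom C h = Cod C g; Dom C g = Cod C f\<rbrakk>
    \<Longrightarrow> (h \<cdot> g) \<cdot> f = h \<cdot> (g \<cdot> f)"
  by (rule comp_assoc) (auto simp: Hom_def)

declare tens_ident [simp]

lemma tens_comp_arr:
  "\<lbrakk>f \<in> Arr C; g \<in> Arr C; f' \<in> Arr C; g' \<in> Arr C; Dom C g = Cod C f; Dom C g' = Cod C f'\<rbrakk>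
    \<Longrightarrow> (g \<boxtimes> g') \<cdot> (f \<boxtimes> f') = (g \<cdot> f) \<boxtimes> (g' \<cdot> f')"
  by (rule tens_comp[symmetric]) (auto simp: Hom_def)

text \<open>Composites are normalised to right-bracketed form, where two adjacent tensor products
  are usually followed by a remainder \<open>h\<close>; this is the interchange law for that
  situation.\<close>

lemma tens_comp_arr_assoc:
  "\<lbrakk>f \<in> Arr C; g \<in> Arr C; f' \<in> Arr C; g' \<in> Arr C; h \<in> Arr C;
    Dom C g = Cod C f; Dom C g' = Cod C f'; Cod C h = Dom C f \<otimes> Dom C f'\<rbrakk>
    \<Longrightarrow> (g \<boxtimes> g') \<cdot> ((f \<boxtimes> f') \<cdot> h) = ((g \<cdot> f) \<boxtimes> (g' \<cdot> f')) \<cdot> h"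
  by (subst comp_assoc_arr[symmetric]) (auto simp: tens_comp_arr)

lemmas merge = tens_comp_arr tens_comp_arr_assoc

text \<open>Naming the codomains by variables lets the left side match index objects in any form;
  the equalities become side conditions. The other naturality rules follow the same pattern.\<close>

lemma assoc_nat:
  "\<lbrakk>f \<in> Arr C; g \<in> Arr C; h \<in> Arr C; Cod C f = a'; Cod C g = b'; Cod C h = c'\<rbrakk>
    \<Longrightarrow> Assoc C a' b' c' \<cdot> ((f \<boxtimes> g) \<boxtimes> h) = (f \<boxtimes> (g \<boxtimes> h)) \<cdot> Assoc C (Dom C f) (Dom C g) (Dom C h)"
  by (rule assoc_natural) (auto simp: Hom_def)

lemma lunit_nat:
  "\<lbrakk>f \<in> Arr C; Cod C f = b\<rbrakk> \<Longrightarrow> LUnit C b \<cdot> (Ident C (UnitO C) \<boxtimes> f) = f \<cdot> LUnit C (Dom C f)"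
  by (rule lunit_natural) (auto simp: Hom_def)

lemma runit_nat:
  "\<lbrakk>f \<in> Arr C; Cod C f = b\<rbrakk> \<Longrightarrow> RUnit C b \<cdot> (f \<boxtimes> Ident C (UnitO C)) = f \<cdot> RUnit C (Dom C f)"
  by (rule runit_natural) (auto simp: Hom_def)

lemma braid_nat:
  "\<lbrakk>f \<in> Arr C; g \<in> Arr C; Cod C f = a'; Cod C g = b'\<rbrakk>
    \<Longrightarrow> Braid C a' b' \<cdot> (f \<boxtimes> g) = (g \<boxtimes> f) \<cdot> Braid C (Dom C f) (Dom C g)"
  by (rule braid_natural) (auto simp: Hom_def)

section \<open>Isomorphisms and cancellation\<close>

definition inv_arrow :: "'m \<Rightarrow> 'm" where
  "inv_arrow f = (SOME g. inverse_arrows C f g)"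

lemma inverse_arrows_inv_arrow: "iso_arrow C f \<Longrightarrow> inverse_arrows C f (inv_arrow f)"
  unfolding iso_arrow_def inv_arrow_def by (rule someI_ex)

lemma inv_arrow_simps [simp]:
  assumes "iso_arrow C f"
  shows "inv_arrow f \<in> Arr C" "Dom C (inv_arrow f) = Cod C f" "Cod C (inv_arrow f) = Dom C f"
    "inv_arrow f \<cdot> f = Ident C (Dom C f)" "f \<cdot> inv_arrow f = Ident C (Cod C f)"
  using inverse_arrows_inv_arrow[OF assms] by (auto simp: inverse_arrows_def Hom_def)

lemma iso_arrow_arr: "iso_arrow C f \<Longrightarrow> f \<in> Arr C"
  by (auto simp: iso_arrow_def inverse_arrows_def)

lemma inv_arrow_comp_assoc [simp]:
  assumes "iso_arrow C f" "h \<in> Arr C"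
  shows "Cod C h = Dom C f \<Longrightarrow> inv_arrow f \<cdot> (f \<cdot> h) = h"
    "Cod C h = Cod C f \<Longrightarrow> f \<cdot> (inv_arrow f \<cdot> h) = h"
  using assms iso_arrow_arr[OF assms(1)] by (simp_all flip: comp_assoc_arr)

lemma iso_arrowI:
  "\<lbrakk>f \<in> Arr C; g \<in> Arr C; Dom C g = Cod C f; Cod C g = Dom C f;
    g \<cdot> f = Ident C (Dom C f); f \<cdot> g = Ident C (Cod C f)\<rbrakk> \<Longrightarrow> iso_arrow C f"
  by (auto simp: iso_arrow_def inverse_arrows_def Hom_def)

text \<open>Only the braiding needs an argument: by symmetry its inverse is the opposite
  braiding.\<close>

lemma iso_coherence [simp]:
  "\<lbrakk>a \<in> Obj C; b \<in> Obj C; c \<in> Obj C\<rbrakk> \<Longrightarrow> iso_arrow C (Assoc C a b c)"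
  "a \<in> Obj C \<Longrightarrow> iso_arrow C (LUnit C a)"
  "a \<in> Obj C \<Longrightarrow> iso_arrow C (RUnit C a)"
  "\<lbrakk>a \<in> Obj C; b \<in> Obj C\<rbrakk> \<Longrightarrow> iso_arrow C (Braid C a b)"
  by (auto simp: assoc_iso lunit_iso runit_iso
      intro!: iso_arrowI[of "Braid C a b" "Braid C b a"] braid_symmetric)

lemma iso_ident [simp]: "a \<in> Obj C \<Longrightarrow> iso_arrow C (Ident C a)"
  by (rule iso_arrowI[of _ "Ident C a"]) auto

lemma iso_inv_arrow [simp]: "iso_arrow C f \<Longrightarrow> iso_arrow C (inv_arrow f)"
  using iso_arrow_arr by (intro iso_arrowI[of _ f]) auto

lemma iso_comp [simp]:
  assumes "iso_arrow C f" "iso_arrow C g" "Dom C g = Cod C f"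
  shows "iso_arrow C (g \<cdot> f)"
  using assms iso_arrow_arr[OF assms(1)] iso_arrow_arr[OF assms(2)]
  by (intro iso_arrowI[of _ "inv_arrow f \<cdot> inv_arrow g"]) auto

lemma iso_tens [simp]:
  assumes "iso_arrow C f" "iso_arrow C g"
  shows "iso_arrow C (f \<boxtimes> g)"
  using assms iso_arrow_arr[OF assms(1)] iso_arrow_arr[OF assms(2)]
  by (intro iso_arrowI[of _ "inv_arrow f \<boxtimes> inv_arrow g"]) (auto simp: merge)

lemma iso_cancel_right:
  assumes "iso_arrow C e" "f \<in> Arr C" "g \<in> Arr C" "Dom C f = Cod C e" "Dom C g = Cod C e"
    and "f \<cdot> e = g \<cdot> e"
  shows "f = g"
proof -
  have "(f \<cdot> e) \<cdot> inv_arrow e = (g \<cdot> e) \<cdot> inv_arrow e" using assms(6) by simp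
  then show ?thesis using assms(1-5) iso_arrow_arr[OF assms(1)] by simp
qed

text \<open>By naturality of the left unitor, \<open>f\<close> is conjugate to
  \<open>Ident C (UnitO C) \<boxtimes> f\<close> by isomorphisms that depend only on the end
  objects.\<close>

lemma unit_tens_faithful:
  assumes "f \<in> Arr C" "g \<in> Arr C" "Dom C f = Dom C g" "Cod C f = Cod C g"
    and "Ident C (UnitO C) \<boxtimes> f = Ident C (UnitO C) \<boxtimes> g"
  shows "f = g"
proof (rule iso_cancel_right[of "LUnit C (Dom C f)"])
  show "f \<cdot> LUnit C (Dom C f) = g \<cdot> LUnit C (Dom C f)"
    using lunit_nat[of f "Cod C f"] lunit_nat[of g "Cod C f"] assms by simp
qed (use assms in auto)

lemma tens_unit_faithful:
  assumes "f \<in> Arr C" "g \<in> Arr C" "Dom C f = Dom C g" "Cod C f = Cod C g"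
    and "f \<boxtimes> Ident C (UnitO C) = g \<boxtimes> Ident C (UnitO C)"
  shows "f = g"
proof (rule iso_cancel_right[of "RUnit C (Dom C f)"])
  show "f \<cdot> RUnit C (Dom C f) = g \<cdot> RUnit C (Dom C f)"
    using runit_nat[of f "Cod C f"] runit_nat[of g "Cod C f"] assms by simp
qed (use assms in auto)

lemma pentagon_arr:
  assumes "a \<in> Obj C" "b \<in> Obj C" "c \<in> Obj C" "d \<in> Obj C"
  shows "(Ident C a \<boxtimes> Assoc C b c d) \<cdot> (Assoc C a (b \<otimes> c) d \<cdot> (Assoc C a b c \<boxtimes> Ident C d))
    = Assoc C a b (c \<otimes> d) \<cdot> Assoc C (a \<otimes> b) c d"
  using pentagon[OF assms] assms by simp

text \<open>Kelly's argument: tensoring with \<open>I\<close> on the left is faithful.\<close>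

lemma lunit_tens:
  assumes x: "x \<in> Obj C" and z: "z \<in> Obj C"
  shows "LUnit C (x \<otimes> z) \<cdot> Assoc C (UnitO C) x z = LUnit C x \<boxtimes> Ident C z" (is "?f = ?g")
proof (rule unit_tens_faithful)
  let ?I = "UnitO C"
  \<comment> \<open>\<open>?e\<close> consists of the first two arrows on the three-arrow side of
    the pentagon for \<open>I\<close>, \<open>I\<close>, \<open>x\<close>, \<open>z\<close>.
    Composing with it makes the pentagon and then the triangle applicable.\<close>
  let ?e = "Assoc C ?I (?I \<otimes> x) z \<cdot> (Assoc C ?I ?I x \<boxtimes> Ident C z)"
  show "Ident C ?I \<boxtimes> ?f = Ident C ?I \<boxtimes> ?g"
  proof (rule iso_cancel_right[of ?e])
    have "(Ident C ?I \<boxtimes> ?f) \<cdot> ?e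
        = (Ident C ?I \<boxtimes> LUnit C (x \<otimes> z)) \<cdot> ((Ident C ?I \<boxtimes> Assoc C ?I x z) \<cdot> ?e)"
      using x z by (simp add: merge)
    also have "\<dots> = ((Ident C ?I \<boxtimes> LUnit C (x \<otimes> z)) \<cdot> Assoc C ?I ?I (x \<otimes> z)) \<cdot> Assoc C (?I \<otimes> ?I) x z"
      using x z by (simp add: pentagon_arr)
    also have "\<dots> = (RUnit C ?I \<boxtimes> (Ident C x \<boxtimes> Ident C z)) \<cdot> Assoc C (?I \<otimes> ?I) x z"
      using x z by (subst triangle) auto
    also have "\<dots> = Assoc C ?I x z \<cdot> ((RUnit C ?I \<boxtimes> Ident C x) \<boxtimes> Ident C z)"
      using x z by (subst assoc_nat) auto
    also have "\<dots> = Assoc C ?I x z \<cdot> (((Ident C ?I \<boxtimes> LUnit C x) \<cdot> Assoc C ?I ?I x) \<boxtimes> Ident C z)"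
      using x z by (subst triangle) auto
    also have "\<dots> = (Assoc C ?I x z \<cdot> ((Ident C ?I \<boxtimes> LUnit C x) \<boxtimes> Ident C z)) \<cdot> (Assoc C ?I ?I x \<boxtimes> Ident C z)"
      using x z by (simp add: merge)
    also have "\<dots> = (Ident C ?I \<boxtimes> ?g) \<cdot> ?e"
      using x z by (subst assoc_nat) auto
    finally show "(Ident C ?I \<boxtimes> ?f) \<cdot> ?e = (Ident C ?I \<boxtimes> ?g) \<cdot> ?e" .
  qed (use x z in auto)
qed (use x z in auto)

section \<open>The strict model: words acting on objects\<close>

text \<open>The letters are the objects themselves, so a word remembers the bracketing that its
  value may lose.\<close>

abbreviation ev :: "'o word \<Rightarrow> 'o" where
  "ev \<equiv> wobj C (\<lambda>x. x)"

definition wf_word :: "'o word \<Rightarrow> bool" where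
  "wf_word X \<longleftrightarrow> set_word X \<subseteq> Obj C"

lemma wf_word_simps [simp]:
  "wf_word (Var a) \<longleftrightarrow> a \<in> Obj C"
  "wf_word One"
  "wf_word (Tens X Y) \<longleftrightarrow> wf_word X \<and> wf_word Y"
  by (auto simp: wf_word_def)

lemma ev_obj [simp]: "wf_word X \<Longrightarrow> ev X \<in> Obj C"
  by (induction X) auto

text \<open>A product acts by composition and \<open>One\<close> by the identity function, so
  rebracketing a word or inserting units does not change its action.\<close>

primrec act :: "'o word \<Rightarrow> 'o \<Rightarrow> 'o" where
  "act (Var a) z = a \<otimes> z"
| "act One z = z"
| "act (Tens X Y) z = act X (act Y z)"

primrec actA :: "'o word \<Rightarrow> 'm \<Rightarrow> 'm" where
  "actA (Var a) f = Ident C a \<boxtimes> f"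
| "actA One f = f"
| "actA (Tens X Y) f = actA X (actA Y f)"

text \<open>The comparison isomorphism from \<open>ev X \<otimes> z\<close> to
  \<open>act X z\<close>. For a product the brackets are moved to the right, then \<open>Y\<close>
  is absorbed into \<open>z\<close>, and finally \<open>X\<close>.\<close>

primrec phi :: "'o word \<Rightarrow> 'o \<Rightarrow> 'm" where
  "phi (Var a) z = Ident C (a \<otimes> z)"
| "phi One z = LUnit C z"
| "phi (Tens X Y) z =
    phi X (act Y z) \<cdot> ((Ident C (ev X) \<boxtimes> phi Y z) \<cdot> Assoc C (ev X) (ev Y) z)"

lemma act_obj [simp]: "\<lbrakk>wf_word X; z \<in> Obj C\<rbrakk> \<Longrightarrow> act X z \<in> Obj C"
  by (induction X arbitrary: z) auto

lemma actA_simps [simp]: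
  assumes "wf_word X" "f \<in> Arr C"
  shows "actA X f \<in> Arr C" "Dom C (actA X f) = act X (Dom C f)" "Cod C (actA X f) = act X (Cod C f)"
proof -
  have "actA X f \<in> Arr C \<and> Dom C (actA X f) = act X (Dom C f) \<and> Cod C (actA X f) = act X (Cod C f)"
    using assms by (induction X arbitrary: f) auto
  then show "actA X f \<in> Arr C" "Dom C (actA X f) = act X (Dom C f)" "Cod C (actA X f) = act X (Cod C f)"
    by auto
qed

lemma actA_ident [simp]: "\<lbrakk>wf_word X; z \<in> Obj C\<rbrakk> \<Longrightarrow> actA X (Ident C z) = Ident C (act X z)"
  by (induction X arbitrary: z) auto

lemma actA_comp:
  "\<lbrakk>wf_word X; f \<in> Arr C; g \<in> Arr C; Dom C g = Cod C f\<rbrakk>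
    \<Longrightarrow> actA X (g \<cdot> f) = actA X g \<cdot> actA X f"
  by (induction X arbitrary: f g) (auto simp: merge)

lemma phi_arr:
  "\<lbrakk>wf_word X; z \<in> Obj C\<rbrakk> \<Longrightarrow>
    phi X z \<in> Arr C \<and> Dom C (phi X z) = ev X \<otimes> z \<and> Cod C (phi X z) = act X z \<and> iso_arrow C (phi X z)"
  by (induction X arbitrary: z) auto

lemma phi_simps [simp]:
  assumes "wf_word X" "z \<in> Obj C"
  shows "phi X z \<in> Arr C" "Dom C (phi X z) = ev X \<otimes> z" "Cod C (phi X z) = act X z"
    "iso_arrow C (phi X z)"
  using phi_arr[OF assms] by auto

text \<open>The associators and left unitors from which \<open>phi\<close> is built are natural in
  \<open>z\<close>; the induction pastes their squares.\<close>

lemma phi_nat: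
  "\<lbrakk>wf_word X; f \<in> Arr C; Cod C f = w\<rbrakk>
    \<Longrightarrow> phi X w \<cdot> (Ident C (ev X) \<boxtimes> f) = actA X f \<cdot> phi X (Dom C f)"
proof (induction X arbitrary: f w)
  case (Var a)
  then show ?case by auto
next
  case One
  then show ?case by (simp add: lunit_nat)
next
  case (Tens X Y)
  then have wf: "wf_word X" "wf_word Y" and f: "f \<in> Arr C" "Cod C f = w" and w: "w \<in> Obj C" by auto
  let ?a = "Ident C (ev X)"
  have "phi (Tens X Y) w \<cdot> (Ident C (ev (Tens X Y)) \<boxtimes> f)
      = phi X (act Y w) \<cdot> ((?a \<boxtimes> phi Y w)
          \<cdot> (Assoc C (ev X) (ev Y) w \<cdot> ((?a \<boxtimes> Ident C (ev Y)) \<boxtimes> f)))"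
    using wf f w by simp
  also have "\<dots> = phi X (act Y w) \<cdot> ((?a \<boxtimes> (phi Y w \<cdot> (Ident C (ev Y) \<boxtimes> f)))
          \<cdot> Assoc C (ev X) (ev Y) (Dom C f))"
    using wf f w by (subst assoc_nat) (auto simp: merge)
  also have "\<dots> = phi X (act Y w) \<cdot> ((?a \<boxtimes> (actA Y f \<cdot> phi Y (Dom C f)))
          \<cdot> Assoc C (ev X) (ev Y) (Dom C f))"
    using Tens.IH(2)[OF wf(2) f] by simp
  also have "\<dots> = (phi X (act Y w) \<cdot> (?a \<boxtimes> actA Y f))
          \<cdot> ((?a \<boxtimes> phi Y (Dom C f)) \<cdot> Assoc C (ev X) (ev Y) (Dom C f))"
    using wf f w by (simp add: merge)
  also have "\<dots> = actA (Tens X Y) f \<cdot> phi (Tens X Y) (Dom C f)"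
    using wf f w by (subst Tens.IH(1)) auto
  finally show ?case .
qed

text \<open>\<open>F\<close> is \<open>f \<otimes> z\<close> transported along \<open>phi\<close>.\<close>

definition represents :: "'o word \<Rightarrow> 'o word \<Rightarrow> 'm \<Rightarrow> ('o \<Rightarrow> 'm) \<Rightarrow> bool" where
  "represents X Y f F \<longleftrightarrow> wf_word X \<and> wf_word Y \<and> f \<in> Arr C \<and> Dom C f = ev X \<and> Cod C f = ev Y \<and>
    (\<forall>z \<in> Obj C. F z \<in> Arr C \<and> Dom C (F z) = act X z \<and> Cod C (F z) = act Y z \<and>
      phi Y z \<cdot> (f \<boxtimes> Ident C z) = F z \<cdot> phi X z)"

section \<open>Calculus of transported arrows\<close>

lemma represents_simps:
  assumes "represents X Y f F"
  shows "wf_word X" "wf_word Y" "f \<in> Arr C" "Dom C f = ev X" "Cod C f = ev Y"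
    "z \<in> Obj C \<Longrightarrow> F z \<in> Arr C" "z \<in> Obj C \<Longrightarrow> Dom C (F z) = act X z"
    "z \<in> Obj C \<Longrightarrow> Cod C (F z) = act Y z"
  using assms by (auto simp: represents_def)

lemma represents_eq:
  "\<lbrakk>represents X Y f F; z \<in> Obj C\<rbrakk> \<Longrightarrow> phi Y z \<cdot> (f \<boxtimes> Ident C z) = F z \<cdot> phi X z"
  by (simp add: represents_def)

lemma represents_comp:
  assumes "represents X Y f F" "represents Y Z g G"
  shows "represents X Z (g \<cdot> f) (\<lambda>z. G z \<cdot> F z)"
  unfolding represents_def
proof (intro conjI ballI)
  fix z assume z: "z \<in> Obj C"
  note f = represents_simps[OF assms(1)] and g = represents_simps[OF assms(2)]
  have "phi Z z \<cdot> ((g \<cdot> f) \<boxtimes> Ident C z) = (phi Z z \<cdot> (g \<boxtimes> Ident C z)) \<cdot> (f \<boxtimes> Ident C z)"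
    using f g z by (simp add: merge)
  also have "\<dots> = G z \<cdot> (phi Y z \<cdot> (f \<boxtimes> Ident C z))"
    using f g z by (simp add: represents_eq[OF assms(2)])
  also have "\<dots> = (G z \<cdot> F z) \<cdot> phi X z"
    using f g z by (simp add: represents_eq[OF assms(1)])
  finally show "phi Z z \<cdot> ((g \<cdot> f) \<boxtimes> Ident C z) = (G z \<cdot> F z) \<cdot> phi X z" .
qed (use assms in \<open>auto simp: represents_def\<close>)

text \<open>Split \<open>f \<boxtimes> f'\<close> into \<open>f'\<close> followed by
  \<open>f\<close>. The first acts below \<open>X\<close>, the second on an object into which
  \<open>Y'\<close> is already absorbed; naturality of the associator and of \<open>phi\<close>
  separates the two.\<close>

lemma represents_tens:
  assumes "represents X Y f F" "represents X' Y' f' F'"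
  shows "represents (Tens X X') (Tens Y Y') (f \<boxtimes> f') (\<lambda>z. F (act Y' z) \<cdot> actA X (F' z))"
  unfolding represents_def
proof (intro conjI ballI)
  fix z assume z: "z \<in> Obj C"
  note f = represents_simps[OF assms(1)] and f' = represents_simps[OF assms(2)]
  have "phi (Tens Y Y') z \<cdot> ((f \<boxtimes> f') \<boxtimes> Ident C z)
      = phi Y (act Y' z) \<cdot> ((Ident C (ev Y) \<boxtimes> phi Y' z)
          \<cdot> (Assoc C (ev Y) (ev Y') z \<cdot> ((f \<boxtimes> f') \<boxtimes> Ident C z)))"
    using f f' z by simp
  also have "\<dots> = phi Y (act Y' z) \<cdot> ((f \<boxtimes> (phi Y' z \<cdot> (f' \<boxtimes> Ident C z))) \<cdot> Assoc C (ev X) (ev X') z)"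
    using f f' z by (subst assoc_nat) (auto simp: merge)
  also have "\<dots> = (phi Y (act Y' z) \<cdot> (f \<boxtimes> Ident C (act Y' z)))
      \<cdot> ((Ident C (ev X) \<boxtimes> F' z) \<cdot> ((Ident C (ev X) \<boxtimes> phi X' z) \<cdot> Assoc C (ev X) (ev X') z))"
    using f f' z by (simp add: merge represents_eq[OF assms(2)])
  also have "\<dots> = F (act Y' z) \<cdot> ((phi X (act Y' z) \<cdot> (Ident C (ev X) \<boxtimes> F' z))
      \<cdot> ((Ident C (ev X) \<boxtimes> phi X' z) \<cdot> Assoc C (ev X) (ev X') z))"
    using f f' z by (subst represents_eq[OF assms(1)]) auto
  also have "\<dots> = (F (act Y' z) \<cdot> actA X (F' z)) \<cdot> phi (Tens X X') z"
    using f f' z by (subst phi_nat) auto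
  finally show "phi (Tens Y Y') z \<cdot> ((f \<boxtimes> f') \<boxtimes> Ident C z)
    = (F (act Y' z) \<cdot> actA X (F' z)) \<cdot> phi (Tens X X') z" .
qed (use assms in \<open>auto simp: represents_def\<close>)

lemma represents_ident:
  "wf_word X \<Longrightarrow> represents X X (Ident C (ev X)) (\<lambda>z. Ident C (act X z))"
  by (simp add: represents_def)

text \<open>The pentagon together with naturality of the associator says that absorbing three words
  gives the same result from either bracketing.\<close>

lemma represents_assoc:
  assumes wf: "wf_word X" "wf_word Y" "wf_word Z"
  shows "represents (Tens (Tens X Y) Z) (Tens X (Tens Y Z)) (Assoc C (ev X) (ev Y) (ev Z))
    (\<lambda>z. Ident C (act X (act Y (act Z z))))"
  unfolding represents_def
proof (intro conjI ballI)
  fix z assume z: "z \<in> Obj C"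
  let ?x = "ev X" and ?y = "ev Y" and ?z = "ev Z"
  have "phi (Tens X (Tens Y Z)) z \<cdot> (Assoc C ?x ?y ?z \<boxtimes> Ident C z)
     = phi X (act Y (act Z z)) \<cdot> ((Ident C ?x \<boxtimes> phi Y (act Z z))
        \<cdot> ((Ident C ?x \<boxtimes> (Ident C ?y \<boxtimes> phi Z z)) \<cdot> ((Ident C ?x \<boxtimes> Assoc C ?y ?z z)
        \<cdot> (Assoc C ?x (?y \<otimes> ?z) z \<cdot> (Assoc C ?x ?y ?z \<boxtimes> Ident C z)))))"
    using wf z by (simp add: merge)
  also have "\<dots> = phi X (act Y (act Z z)) \<cdot> ((Ident C ?x \<boxtimes> phi Y (act Z z))
        \<cdot> (((Ident C ?x \<boxtimes> (Ident C ?y \<boxtimes> phi Z z)) \<cdot> Assoc C ?x ?y (?z \<otimes> z))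
        \<cdot> Assoc C (?x \<otimes> ?y) ?z z))"
    using wf z by (simp add: pentagon_arr)
  also have "\<dots> = phi X (act Y (act Z z)) \<cdot> ((Ident C ?x \<boxtimes> phi Y (act Z z))
        \<cdot> ((Assoc C ?x ?y (act Z z) \<cdot> ((Ident C ?x \<boxtimes> Ident C ?y) \<boxtimes> phi Z z))
        \<cdot> Assoc C (?x \<otimes> ?y) ?z z))"
    using wf z by (subst assoc_nat) auto
  also have "\<dots> = Ident C (act X (act Y (act Z z))) \<cdot> phi (Tens (Tens X Y) Z) z"
    using wf z by simp
  finally show "phi (Tens X (Tens Y Z)) z \<cdot> (Assoc C ?x ?y ?z \<boxtimes> Ident C z)
     = Ident C (act X (act Y (act Z z))) \<cdot> phi (Tens (Tens X Y) Z) z" .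
qed (use assms in auto)

text \<open>Naturality of the left unitor moves it past \<open>phi X z\<close>; what remains is
  Kelly's identity \<open>lunit_tens\<close>.\<close>

lemma represents_lunit:
  assumes wf: "wf_word X"
  shows "represents (Tens One X) X (LUnit C (ev X)) (\<lambda>z. Ident C (act X z))"
  unfolding represents_def
proof (intro conjI ballI)
  fix z assume z: "z \<in> Obj C"
  have "phi (Tens One X) z = (LUnit C (act X z) \<cdot> (Ident C (UnitO C) \<boxtimes> phi X z)) \<cdot> Assoc C (UnitO C) (ev X) z"
    using wf z by simp
  also have "\<dots> = phi X z \<cdot> (LUnit C (ev X) \<boxtimes> Ident C z)"
    using wf z by (subst lunit_nat) (auto simp: lunit_tens)
  finally show "phi X z \<cdot> (LUnit C (ev X) \<boxtimes> Ident C z) = Ident C (act X z) \<cdot> phi (Tens One X) z"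
    using wf z by simp
qed (use assms in auto)

text \<open>After unfolding \<open>phi\<close> at \<open>One\<close> this is the triangle
  axiom.\<close>

lemma represents_runit:
  assumes wf: "wf_word X"
  shows "represents (Tens X One) X (RUnit C (ev X)) (\<lambda>z. Ident C (act X z))"
  unfolding represents_def
  using assms by (auto simp: triangle)

text \<open>Meant for inverse associators and unitors. Since \<open>F z\<close> is an identity whose
  codomain is \<open>act Y z\<close>, the two words act equally at \<open>z\<close>, and the same
  \<open>F\<close> serves for the inverse.\<close>

lemma represents_inverse:
  assumes "represents X Y f F" and "iso_arrow C f" and "\<And>z. z \<in> Obj C \<Longrightarrow> F z = Ident C (act X z)"
  shows "represents Y X (inv_arrow f) F"
  unfolding represents_def
proof (intro conjI ballI)
  fix z assume z: "z \<in> Obj C"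
  note f = represents_simps[OF assms(1)]
  have XY: "act Y z = act X z" using f assms(3)[OF z] z by (metis ident_simps(3) act_obj)
  have "phi X z = phi Y z \<cdot> (f \<boxtimes> Ident C z)"
    using represents_eq[OF assms(1) z] f assms(3)[OF z] z by simp
  then have "phi X z \<cdot> (inv_arrow f \<boxtimes> Ident C z)
      = (phi Y z \<cdot> (f \<boxtimes> Ident C z)) \<cdot> (inv_arrow f \<boxtimes> Ident C z)" by simp
  also have "\<dots> = phi Y z" using f z assms(2) by (simp add: merge)
  finally show "phi X z \<cdot> (inv_arrow f \<boxtimes> Ident C z) = F z \<cdot> phi Y z"
    using f z assms(3)[OF z] XY by simp
  show "F z \<in> Arr C" "Dom C (F z) = act Y z" "Cod C (F z) = act X z"
    using f z assms(3)[OF z] XY by auto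
qed (use assms in \<open>auto simp: represents_def\<close>)

text \<open>At \<open>z = I\<close> the isomorphism \<open>phi Y I\<close> cancels, and the right
  unitor then removes the factor \<open>I\<close>. Coherence identities are thereby reduced to
  equations between transported maps.\<close>

lemma represents_faithful:
  assumes "represents X Y f F" "represents X Y g G" "\<And>z. z \<in> Obj C \<Longrightarrow> F z = G z"
  shows "f = g"
proof (rule tens_unit_faithful)
  let ?I = "UnitO C"
  note f = represents_simps[OF assms(1)] and g = represents_simps[OF assms(2)]
  have "inv_arrow (phi Y ?I) \<cdot> (phi Y ?I \<cdot> (f \<boxtimes> Ident C ?I))
      = inv_arrow (phi Y ?I) \<cdot> (phi Y ?I \<cdot> (g \<boxtimes> Ident C ?I))"
    using assms(3)[of ?I] by (simp add: represents_eq[OF assms(1)] represents_eq[OF assms(2)])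
  then show "f \<boxtimes> Ident C ?I = g \<boxtimes> Ident C ?I"
    using f g by simp
qed (use assms in \<open>auto simp: represents_def\<close>)

text \<open>Cancelling \<open>phi X z\<close> shows that \<open>f\<close> determines
  \<open>F z\<close>. This carries known identities such as the hexagon into the strict
  model.\<close>

lemma represents_unique:
  assumes "represents X Y f F" "represents X Y f G" "z \<in> Obj C"
  shows "F z = G z"
  by (rule iso_cancel_right[of "phi X z"]) (use assms in \<open>auto simp: represents_def\<close>)

text \<open>Bifunctoriality makes \<open>f \<boxtimes> Ident C z\<close> natural in
  \<open>z\<close>, and conjugation by \<open>phi\<close> preserves this.\<close>

lemma represents_natural:
  assumes "represents X Y f F" "h \<in> Arr C"
  shows "F (Cod C h) \<cdot> actA X h = actA Y h \<cdot> F (Dom C h)"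
proof (rule iso_cancel_right[of "phi X (Dom C h)"])
  note f = represents_simps[OF assms(1)]
  let ?z = "Dom C h" and ?w = "Cod C h"
  have "(F ?w \<cdot> actA X h) \<cdot> phi X ?z = F ?w \<cdot> (phi X ?w \<cdot> (Ident C (ev X) \<boxtimes> h))"
    using f assms(2) by (subst phi_nat) auto
  also have "\<dots> = (F ?w \<cdot> phi X ?w) \<cdot> (Ident C (ev X) \<boxtimes> h)" using f assms(2) by simp
  also have "\<dots> = (phi Y ?w \<cdot> (f \<boxtimes> Ident C ?w)) \<cdot> (Ident C (ev X) \<boxtimes> h)"
    using assms(2) by (subst represents_eq[OF assms(1)]) auto
  also have "\<dots> = (phi Y ?w \<cdot> (Ident C (ev Y) \<boxtimes> h)) \<cdot> (f \<boxtimes> Ident C ?z)"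
    using f assms(2) by (simp add: merge)
  also have "\<dots> = actA Y h \<cdot> (phi Y ?z \<cdot> (f \<boxtimes> Ident C ?z))"
    using f assms(2) by (subst phi_nat) auto
  also have "\<dots> = (actA Y h \<cdot> F ?z) \<cdot> phi X ?z"
    using f assms(2) by (subst represents_eq[OF assms(1)]) auto
  finally show "(F ?w \<cdot> actA X h) \<cdot> phi X ?z = (actA Y h \<cdot> F ?z) \<cdot> phi X ?z" .
qed (use assms in \<open>auto simp: represents_def\<close>)

section \<open>Braidings in the strict model\<close>

text \<open>The transported braiding, an arrow from \<open>act X (act Y z)\<close> to
  \<open>act Y (act X z)\<close>. It is defined by conjugation, so \<open>represents_braid\<close>
  holds by cancellation.\<close>

definition swap :: "'o word \<Rightarrow> 'o word \<Rightarrow> 'o \<Rightarrow> 'm" where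
  "swap X Y z = phi (Tens Y X) z \<cdot> ((Braid C (ev X) (ev Y) \<boxtimes> Ident C z) \<cdot> inv_arrow (phi (Tens X Y) z))"

lemma represents_braid:
  assumes "wf_word X" "wf_word Y"
  shows "represents (Tens X Y) (Tens Y X) (Braid C (ev X) (ev Y)) (swap X Y)"
proof -
  have [simp]: "iso_arrow C (phi (Tens X Y) z)" "phi (Tens X Y) z \<in> Arr C"
    "Dom C (phi (Tens X Y) z) = (ev X \<otimes> ev Y) \<otimes> z" "Cod C (phi (Tens X Y) z) = act X (act Y z)"
    "phi (Tens Y X) z \<in> Arr C"
    "Dom C (phi (Tens Y X) z) = (ev Y \<otimes> ev X) \<otimes> z" "Cod C (phi (Tens Y X) z) = act Y (act X z)"
    if "z \<in> Obj C" for z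
    using assms that phi_arr[of "Tens X Y"] phi_arr[of "Tens Y X"] by (auto simp del: phi.simps)
  show ?thesis
    unfolding represents_def swap_def using assms by (auto simp del: phi.simps)
qed

lemma swap_simps [simp]:
  assumes "wf_word X" "wf_word Y" "z \<in> Obj C"
  shows "swap X Y z \<in> Arr C" "Dom C (swap X Y z) = act X (act Y z)"
    "Cod C (swap X Y z) = act Y (act X z)"
  using represents_braid[OF assms(1,2)] assms(3) by (auto simp: represents_def)

lemma swap_natural:
  "\<lbrakk>wf_word X; wf_word Y; h \<in> Arr C\<rbrakk>
    \<Longrightarrow> swap X Y (Cod C h) \<cdot> actA X (actA Y h) = actA Y (actA X h) \<cdot> swap X Y (Dom C h)"
  using represents_natural[OF represents_braid] by simp

lemma swap_swap:
  assumes "wf_word X" "wf_word Y" "z \<in> Obj C"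
  shows "swap Y X z \<cdot> swap X Y z = Ident C (act X (act Y z))"
  using represents_unique[OF
      represents_comp[OF represents_braid[OF assms(1,2)] represents_braid[OF assms(2,1)]]
      _ assms(3)] represents_ident[of "Tens X Y"] assms
  by (simp add: braid_symmetric)

text \<open>This is the hexagon after its associators have become identities; \<open>L\<close> and
  \<open>R\<close> are its two sides.\<close>

lemma swap_tens_right:
  assumes wf: "wf_word X" "wf_word Y" "wf_word Z" and z: "z \<in> Obj C"
  shows "swap X (Tens Y Z) z = actA Y (swap X Z z) \<cdot> swap X Y (act Z z)"
proof -
  have wfYZ: "wf_word (Tens Y Z)" using wf by simp
  note L = represents_comp[OF represents_comp[OF represents_assoc[OF wf]
      represents_braid[OF wf(1) wfYZ, simplified]] represents_assoc[OF wf(2,3,1)]]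
  note R = represents_comp[OF represents_comp[OF represents_tens[OF represents_braid[OF wf(1,2)]
      represents_ident[OF wf(3)]] represents_assoc[OF wf(2,1,3)]]
      represents_tens[OF represents_ident[OF wf(2)] represents_braid[OF wf(1,3)]]]
  show ?thesis
    using represents_unique[OF L _ z] R hexagon[of "ev X" "ev Y" "ev Z"] swap_simps[OF wf(1) wfYZ z] wf z
    by simp
qed

text \<open>The mirror-image hexagon follows by symmetry: both sides are inverse to
  \<open>swap Z (Tens X Y) z\<close>, which is split by \<open>swap_tens_right\<close>.\<close>

lemma swap_tens_left:
  assumes wf: "wf_word X" "wf_word Y" "wf_word Z" and z: "z \<in> Obj C"
  shows "swap (Tens X Y) Z z = swap X Z (act Y z) \<cdot> actA X (swap Y Z z)"
proof (rule iso_cancel_right)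
  let ?e = "swap Z (Tens X Y) z"
  have wfXY: "wf_word (Tens X Y)" using wf by simp
  have sXY: "swap (Tens X Y) Z z \<cdot> ?e = Ident C (act Z (act X (act Y z)))"
    "?e \<cdot> swap (Tens X Y) Z z = Ident C (act X (act Y (act Z z)))"
    using swap_swap[OF wf(3) wfXY z] swap_swap[OF wfXY wf(3) z] by auto
  show "iso_arrow C ?e"
    using sXY swap_simps[OF wf(3) wfXY z] swap_simps[OF wfXY wf(3) z]
    by (intro iso_arrowI[of ?e "swap (Tens X Y) Z z"]) auto
  have "(swap X Z (act Y z) \<cdot> actA X (swap Y Z z)) \<cdot> ?e
      = swap X Z (act Y z) \<cdot> (actA X (swap Y Z z \<cdot> swap Z Y z) \<cdot> swap Z X (act Y z))"
    using wf z by (simp add: swap_tens_right actA_comp)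
  also have "\<dots> = swap (Tens X Y) Z z \<cdot> ?e"
    using wf z sXY by (simp add: swap_swap)
  finally show "swap (Tens X Y) Z z \<cdot> ?e = (swap X Z (act Y z) \<cdot> actA X (swap Y Z z)) \<cdot> ?e" ..
qed (use wf z swap_simps[of "Tens X Y" Z z] swap_simps[of Z "Tens X Y" z] in auto)

text \<open>The hexagon and naturality along \<open>I \<otimes> I \<cong> I\<close> make this swap idempotent, and it is invertible.\<close>

lemma swap_One_right:
  assumes wf: "wf_word X" and z: "z \<in> Obj C"
  shows "swap X One z = Ident C (act X z)"
proof -
  let ?I = "UnitO C"
  have wf1: "wf_word (Tens One One)" by simp
  have rI: "represents X X (Ident C (ev X)) (\<lambda>z. Ident C (act X z))"
    by (rule represents_ident[OF wf])
  have rL: "represents (Tens One One) One (LUnit C ?I) (\<lambda>z. Ident C z)"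
    using represents_lunit[of One] by simp
  have rB: "represents (Tens X (Tens One One)) (Tens (Tens One One) X) (Braid C (ev X) (?I \<otimes> ?I))
      (swap X (Tens One One))"
    using represents_braid[OF wf wf1] by simp
  have rB1: "represents (Tens X One) (Tens One X) (Braid C (ev X) ?I) (swap X One)"
    using represents_braid[OF wf, of One] by simp
  have "Braid C (ev X) ?I \<cdot> (Ident C (ev X) \<boxtimes> LUnit C ?I)
      = (LUnit C ?I \<boxtimes> Ident C (ev X)) \<cdot> Braid C (ev X) (?I \<otimes> ?I)"
    using wf by (subst braid_nat) auto
  then have "swap X One z = swap X (Tens One One) z"
    using represents_unique[OF represents_comp[OF represents_tens[OF rI rL] rB1] _ z]
      represents_comp[OF rB represents_tens[OF rL rI]] wf z swap_simps[OF wf wf1 z]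
    by simp
  also have "\<dots> = swap X One z \<cdot> swap X One z"
    using wf z by (simp add: swap_tens_right)
  finally have idem: "swap X One z \<cdot> swap X One z = swap X One z" ..
  have "swap X One z = swap One X z \<cdot> (swap X One z \<cdot> swap X One z)"
    using wf z swap_swap[OF wf _ z, of One]
    by (subst comp_assoc_arr[symmetric]) auto
  also have "\<dots> = Ident C (act X z)"
    unfolding idem using wf z swap_swap[OF wf _ z, of One] by simp
  finally show ?thesis .
qed

lemma swap_One_left:
  assumes wf: "wf_word X" and z: "z \<in> Obj C"
  shows "swap One X z = Ident C (act X z)"
  using swap_swap[OF wf _ z, of One] swap_One_right[OF wf z] swap_simps[OF _ wf z, of One] wf z
  by simp

section \<open>The middle-four interchange and its coherence identities\<close>

text \<open>The canonical map from \<open>(a \<otimes> a') \<otimes> (b \<otimes> b')\<close> to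
  \<open>(a \<otimes> b) \<otimes> (a' \<otimes> b')\<close>: rebracket, braid \<open>a'\<close>
  past \<open>b\<close>, rebracket. The arguments are listed in the order of the source.\<close>

definition interchange :: "'o \<Rightarrow> 'o \<Rightarrow> 'o \<Rightarrow> 'o \<Rightarrow> 'm" where
  "interchange a a' b b' = inv_arrow (Assoc C a b (a' \<otimes> b')) \<cdot>
    ((Ident C a \<boxtimes> (Assoc C b a' b' \<cdot>
        ((Braid C a' b \<boxtimes> Ident C b') \<cdot> inv_arrow (Assoc C a' b b')))) \<cdot> Assoc C a a' (b \<otimes> b'))"

lemma interchange_simps [simp]:
  assumes "a \<in> Obj C" "a' \<in> Obj C" "b \<in> Obj C" "b' \<in> Obj C"
  shows "interchange a a' b b' \<in> Arr C"
    "Dom C (interchange a a' b b') = (a \<otimes> a') \<otimes> (b \<otimes> b')"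
    "Cod C (interchange a a' b b') = (a \<otimes> b) \<otimes> (a' \<otimes> b')"
    "iso_arrow C (interchange a a' b b')"
  using assms by (auto simp: interchange_def)

lemma inv_assoc_nat:
  assumes "f \<in> Arr C" "g \<in> Arr C" "h \<in> Arr C" "Cod C f = a" "Cod C g = b" "Cod C h = c"
  shows "inv_arrow (Assoc C a b c) \<cdot> (f \<boxtimes> (g \<boxtimes> h))
    = ((f \<boxtimes> g) \<boxtimes> h) \<cdot> inv_arrow (Assoc C (Dom C f) (Dom C g) (Dom C h))"
proof (rule iso_cancel_right)
  have "(inv_arrow (Assoc C a b c) \<cdot> (f \<boxtimes> (g \<boxtimes> h))) \<cdot> Assoc C (Dom C f) (Dom C g) (Dom C h)
      = inv_arrow (Assoc C a b c) \<cdot> (Assoc C a b c \<cdot> ((f \<boxtimes> g) \<boxtimes> h))"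
    using assms by (subst assoc_nat) auto
  also have "\<dots> = (((f \<boxtimes> g) \<boxtimes> h) \<cdot> inv_arrow (Assoc C (Dom C f) (Dom C g) (Dom C h)))
      \<cdot> Assoc C (Dom C f) (Dom C g) (Dom C h)"
    using assms by auto
  finally show "(inv_arrow (Assoc C a b c) \<cdot> (f \<boxtimes> (g \<boxtimes> h))) \<cdot> Assoc C (Dom C f) (Dom C g) (Dom C h)
    = (((f \<boxtimes> g) \<boxtimes> h) \<cdot> inv_arrow (Assoc C (Dom C f) (Dom C g) (Dom C h)))
      \<cdot> Assoc C (Dom C f) (Dom C g) (Dom C h)" .
qed (use assms in auto)

lemma interchange_natural:
  assumes "f \<in> Arr C" "f' \<in> Arr C" "g \<in> Arr C" "g' \<in> Arr C"
    and "Cod C f = a" "Cod C f' = a'" "Cod C g = b" "Cod C g' = b'"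
  shows "interchange a a' b b' \<cdot> ((f \<boxtimes> f') \<boxtimes> (g \<boxtimes> g'))
    = ((f \<boxtimes> g) \<boxtimes> (f' \<boxtimes> g')) \<cdot> interchange (Dom C f) (Dom C f') (Dom C g) (Dom C g')"
proof -
  \<comment> \<open>\<open>?k\<close> is the inner factor, which moves \<open>a'\<close> past
    \<open>b\<close> in \<open>a' \<otimes> (b \<otimes> b')\<close>. Its naturality is shown first;
    the outer associators are then natural around it.\<close>
  let ?k = "\<lambda>a' b b'. Assoc C b a' b' \<cdot> ((Braid C a' b \<boxtimes> Ident C b') \<cdot> inv_arrow (Assoc C a' b b'))"
  have [simp]: "a \<in> Obj C" "a' \<in> Obj C" "b \<in> Obj C" "b' \<in> Obj C"
    using assms by auto
  let ?d = "Dom C f" and ?d' = "Dom C f'" and ?e = "Dom C g" and ?e' = "Dom C g'"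
  have "?k a' b b' \<cdot> (f' \<boxtimes> (g \<boxtimes> g'))
      = Assoc C b a' b' \<cdot> ((Braid C a' b \<boxtimes> Ident C b')
          \<cdot> (((f' \<boxtimes> g) \<boxtimes> g') \<cdot> inv_arrow (Assoc C ?d' ?e ?e')))"
    using assms by (simp add: inv_assoc_nat)
  also have "\<dots> = Assoc C b a' b' \<cdot> (((g \<boxtimes> f') \<boxtimes> g')
          \<cdot> ((Braid C ?d' ?e \<boxtimes> Ident C ?e') \<cdot> inv_arrow (Assoc C ?d' ?e ?e')))"
    using assms by (simp add: merge braid_nat)
  also have "\<dots> = (Assoc C b a' b' \<cdot> ((g \<boxtimes> f') \<boxtimes> g'))
          \<cdot> ((Braid C ?d' ?e \<boxtimes> Ident C ?e') \<cdot> inv_arrow (Assoc C ?d' ?e ?e'))"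
    using assms by simp
  also have "\<dots> = (g \<boxtimes> (f' \<boxtimes> g')) \<cdot> ?k ?d' ?e ?e'"
    using assms by (subst assoc_nat) auto
  finally have k: "?k a' b b' \<cdot> (f' \<boxtimes> (g \<boxtimes> g')) = (g \<boxtimes> (f' \<boxtimes> g')) \<cdot> ?k ?d' ?e ?e'" .
  have "interchange a a' b b' \<cdot> ((f \<boxtimes> f') \<boxtimes> (g \<boxtimes> g'))
      = inv_arrow (Assoc C a b (a' \<otimes> b')) \<cdot> ((Ident C a \<boxtimes> ?k a' b b')
          \<cdot> (Assoc C a a' (b \<otimes> b') \<cdot> ((f \<boxtimes> f') \<boxtimes> (g \<boxtimes> g'))))"
    unfolding interchange_def using assms by auto
  also have "\<dots> = inv_arrow (Assoc C a b (a' \<otimes> b')) \<cdot> ((Ident C a \<boxtimes> ?k a' b b')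
          \<cdot> ((f \<boxtimes> (f' \<boxtimes> (g \<boxtimes> g'))) \<cdot> Assoc C ?d ?d' (?e \<otimes> ?e')))"
    using assms by (subst assoc_nat) auto
  also have "\<dots> = inv_arrow (Assoc C a b (a' \<otimes> b')) \<cdot> ((f \<boxtimes> (?k a' b b' \<cdot> (f' \<boxtimes> (g \<boxtimes> g'))))
          \<cdot> Assoc C ?d ?d' (?e \<otimes> ?e'))"
    using assms by (subst tens_comp_arr_assoc) auto
  also have "\<dots> = (inv_arrow (Assoc C a b (a' \<otimes> b')) \<cdot> (f \<boxtimes> (g \<boxtimes> (f' \<boxtimes> g'))))
          \<cdot> ((Ident C ?d \<boxtimes> ?k ?d' ?e ?e') \<cdot> Assoc C ?d ?d' (?e \<otimes> ?e'))"
    unfolding k using assms by (simp add: merge)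
  also have "\<dots> = ((f \<boxtimes> g) \<boxtimes> (f' \<boxtimes> g')) \<cdot> interchange ?d ?d' ?e ?e'"
    unfolding interchange_def using assms by (subst inv_assoc_nat) auto
  finally show ?thesis .
qed

lemma represents_cong:
  "\<lbrakk>represents X Y f F; \<And>z. z \<in> Obj C \<Longrightarrow> F z = G z\<rbrakk> \<Longrightarrow> represents X Y f G"
  by (simp add: represents_def)

lemma represents_inv_assoc:
  assumes wf: "wf_word X" "wf_word Y" "wf_word Z"
  shows "represents (Tens X (Tens Y Z)) (Tens (Tens X Y) Z) (inv_arrow (Assoc C (ev X) (ev Y) (ev Z)))
    (\<lambda>z. Ident C (act X (act Y (act Z z))))"
  using wf by (intro represents_inverse[OF represents_assoc[OF wf]]) auto

text \<open>The four associators transport to identities, leaving the swap of the two middle words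
  below \<open>X\<close>.\<close>

lemma represents_interchange:
  assumes wf: "wf_word X" "wf_word X'" "wf_word Y" "wf_word Y'"
  shows "represents (Tens (Tens X X') (Tens Y Y')) (Tens (Tens X Y) (Tens X' Y'))
    (interchange (ev X) (ev X') (ev Y) (ev Y')) (\<lambda>z. actA X (swap X' Y (act Y' z)))"
proof -
  note k = represents_comp[OF represents_comp[OF represents_inv_assoc[OF wf(2,3,4)]
      represents_tens[OF represents_braid[OF wf(2,3)] represents_ident[OF wf(4)]]]
      represents_assoc[OF wf(3,2,4)]]
  have wf': "wf_word (Tens Y Y')" "wf_word (Tens X' Y')" using wf by auto
  note * = represents_comp[OF represents_comp[OF represents_assoc[OF wf(1,2) wf'(1)]
      represents_tens[OF represents_ident[OF wf(1)] k]] represents_inv_assoc[OF wf(1,3) wf'(2)]]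
  show ?thesis
    unfolding interchange_def
    by (rule represents_cong[OF *[simplified wobj.simps]]) (use wf in auto)
qed

text \<open>Transported, each side swaps the pairs \<open>a'\<close>, \<open>b\<close> and
  \<open>b'\<close>, \<open>c\<close> and then \<open>a'\<close>, \<open>c\<close>. The sides differ
  only in the order of the first two swaps, which commute by \<open>swap_natural\<close>.\<close>

lemma interchange_assoc:
  assumes obj: "a \<in> Obj C" "a' \<in> Obj C" "b \<in> Obj C" "b' \<in> Obj C" "c \<in> Obj C" "c' \<in> Obj C"
  shows "(Assoc C a b c \<boxtimes> Assoc C a' b' c') \<cdot>
      (interchange (a \<otimes> b) (a' \<otimes> b') c c' \<cdot> (interchange a a' b b' \<boxtimes> Ident C (c \<otimes> c')))
    = interchange a a' (b \<otimes> c) (b' \<otimes> c') \<cdot>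
      ((Ident C (a \<otimes> a') \<boxtimes> interchange b b' c c') \<cdot> Assoc C (a \<otimes> a') (b \<otimes> b') (c \<otimes> c'))"
proof -
  have wf: "wf_word (Var a)" "wf_word (Var a')" "wf_word (Var b)" "wf_word (Var b')"
    "wf_word (Var c)" "wf_word (Var c')" "wf_word (Tens (Var a) (Var b))"
    "wf_word (Tens (Var a') (Var b'))" "wf_word (Tens (Var b) (Var c))"
    "wf_word (Tens (Var b') (Var c'))" "wf_word (Tens (Var a) (Var a'))"
    "wf_word (Tens (Var b) (Var b'))" "wf_word (Tens (Var c) (Var c'))"
    using obj by auto
  note L = represents_comp[OF represents_comp[OF
      represents_tens[OF represents_interchange[OF wf(1-4)] represents_ident[OF wf(13)]]
      represents_interchange[OF wf(7,8,5,6)]]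
      represents_tens[OF represents_assoc[OF wf(1,3,5)] represents_assoc[OF wf(2,4,6)]]]
  note R = represents_comp[OF represents_comp[OF represents_assoc[OF wf(11-13)]
      represents_tens[OF represents_ident[OF wf(11)] represents_interchange[OF wf(3-6)]]]
      represents_interchange[OF wf(1,2,9,10)]]
  show ?thesis
    by (rule represents_faithful[OF L[simplified wobj.simps] R[simplified wobj.simps]])
      (use obj swap_natural[OF wf(2,3) swap_simps(1)[OF wf(4,5), of "c' \<otimes> _"]] in
        \<open>simp add: swap_tens_left swap_tens_right actA_comp merge\<close>)
qed

text \<open>On the right the block braiding crosses all four pairs, and the interchange after it
  undoes the crossing of \<open>a\<close> and \<open>b'\<close>. The three remaining swaps agree
  with those on the left once the swaps of \<open>a\<close>, \<open>b\<close> and of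
  \<open>a'\<close>, \<open>b'\<close> are commuted.\<close>

lemma interchange_braid:
  assumes obj: "a \<in> Obj C" "a' \<in> Obj C" "b \<in> Obj C" "b' \<in> Obj C"
  shows "(Braid C a b \<boxtimes> Braid C a' b') \<cdot> interchange a a' b b'
    = interchange b b' a a' \<cdot> Braid C (a \<otimes> a') (b \<otimes> b')"
proof -
  have wf: "wf_word (Var a)" "wf_word (Var a')" "wf_word (Var b)" "wf_word (Var b')"
    "wf_word (Tens (Var a) (Var a'))" "wf_word (Tens (Var b) (Var b'))"
    using obj by auto
  note L = represents_comp[OF represents_interchange[OF wf(1-4)]
      represents_tens[OF represents_braid[OF wf(1,3)] represents_braid[OF wf(2,4)]]]
  note R = represents_comp[OF represents_braid[OF wf(5,6)] represents_interchange[OF wf(3,4,1,2)]]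
  show ?thesis
  proof (rule represents_faithful[OF L[simplified wobj.simps] R[simplified wobj.simps]])
    fix z assume z: "z \<in> Obj C"
    \<comment> \<open>\<open>?X\<close> is the crossing of \<open>a\<close> and \<open>b'\<close>
      inside the block swap, \<open>?Y\<close> the one that undoes it. The cancellation is stated
      with a remainder \<open>h\<close>, to be instantiated by the other three swaps.\<close>
    let ?X = "Ident C b \<boxtimes> swap (Var a) (Var b') (a' \<otimes> z)"
    let ?Y = "Ident C b \<boxtimes> swap (Var b') (Var a) (a' \<otimes> z)"
    have "?Y \<cdot> (?X \<cdot> h) = h"
      if "h \<in> Arr C" "Cod C h = b \<otimes> (a \<otimes> (b' \<otimes> (a' \<otimes> z)))" for h
      using that obj z swap_swap[OF wf(1,4), of "a' \<otimes> z"] by (simp add: merge)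
    from this[of "(Ident C b \<boxtimes> (Ident C a \<boxtimes> swap (Var a') (Var b') z)) \<cdot>
        (swap (Var a) (Var b) (a' \<otimes> (b' \<otimes> z)) \<cdot> (Ident C a \<boxtimes> swap (Var a') (Var b) (b' \<otimes> z)))"]
    show "swap (Var a) (Var b) (act (Tens (Var b') (Var a')) z) \<cdot>
        actA (Tens (Var a) (Var b)) (swap (Var a') (Var b') z) \<cdot>
        actA (Var a) (swap (Var a') (Var b) (act (Var b') z))
      = actA (Var b) (swap (Var b') (Var a) (act (Var a') z)) \<cdot>
        swap (Tens (Var a) (Var a')) (Tens (Var b) (Var b')) z"
      using obj z swap_natural[OF wf(1,3) swap_simps(1)[OF wf(2,4) z]] swap_swap[OF wf(1,4), of "a' \<otimes> z"]
      by (simp add: swap_tens_left swap_tens_right actA_comp merge)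
  qed
qed

text \<open>The only swap involved moves \<open>One\<close> past \<open>a\<close>, so both sides
  transport to identities.\<close>

lemma interchange_lunit:
  assumes obj: "a \<in> Obj C" "a' \<in> Obj C"
  shows "(LUnit C a \<boxtimes> LUnit C a') \<cdot> (interchange (UnitO C) (UnitO C) a a'
      \<cdot> (inv_arrow (LUnit C (UnitO C)) \<boxtimes> Ident C (a \<otimes> a'))) = LUnit C (a \<otimes> a')"
proof -
  have wf: "wf_word (Var a)" "wf_word (Var a')" "wf_word One" "wf_word (Tens (Var a) (Var a'))"
    using obj by auto
  have "represents One (Tens One One) (inv_arrow (LUnit C (UnitO C))) (\<lambda>z. Ident C z)"
    using represents_inverse[OF represents_lunit[of One]] by simp
  note L = represents_comp[OF represents_comp[OF represents_tens[OF this represents_ident[OF wf(4)]]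
      represents_interchange[OF wf(3,3,1,2)]]
      represents_tens[OF represents_lunit[OF wf(1)] represents_lunit[OF wf(2)]]]
  show ?thesis
    by (rule represents_faithful[OF L[simplified wobj.simps] represents_lunit[OF wf(4), simplified wobj.simps]])
      (use obj in \<open>simp add: swap_One_left\<close>)
qed

section \<open>Powers and explicit canonical shuffles\<close>

lemma opow_simps [simp]:
  "opow C c 0 = UnitO C" "opow C c (Suc 0) = c" "opow C c (Suc (Suc n)) = opow C c (Suc n) \<otimes> c"
  by (simp_all add: opow_def)

lemma apow_simps [simp]:
  "apow C f 0 = Ident C (UnitO C)" "apow C f (Suc 0) = f"
  "apow C f (Suc (Suc n)) = apow C f (Suc n) \<boxtimes> f"
  by (simp_all add: apow_def)

lemma opow_obj [simp]: "c \<in> Obj C \<Longrightarrow> opow C c n \<in> Obj C"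
  by (induction n rule: induct_nat_012) auto

lemma apow_arr [simp]:
  assumes "f \<in> Arr C"
  shows "apow C f n \<in> Arr C" "Dom C (apow C f n) = opow C (Dom C f) n"
    "Cod C (apow C f n) = opow C (Cod C f) n"
  using assms by (induction n rule: induct_nat_012) auto

lemma apow_comp:
  "\<lbrakk>f \<in> Arr C; g \<in> Arr C; Dom C g = Cod C f\<rbrakk> \<Longrightarrow> apow C (g \<cdot> f) n = apow C g n \<cdot> apow C f n"
  by (induction n rule: induct_nat_012) (auto simp: merge)

text \<open>A recursive construction of the canonical shuffle: one interchange splits off the last
  pair. Exponent 1 is a case of its own because the first power of \<open>c\<close> is
  \<open>c\<close> and not \<open>I \<otimes> c\<close>.\<close>

fun shuf :: "'o \<Rightarrow> 'o \<Rightarrow> nat \<Rightarrow> 'm" where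
  "shuf c d 0 = LUnit C (UnitO C)"
| "shuf c d (Suc 0) = Ident C (c \<otimes> d)"
| "shuf c d (Suc (Suc n)) = (shuf c d (Suc n) \<boxtimes> Ident C (c \<otimes> d))
    \<cdot> interchange (opow C c (Suc n)) c (opow C d (Suc n)) d"

lemma shuf_simps [simp]:
  assumes "c \<in> Obj C" "d \<in> Obj C"
  shows "shuf c d n \<in> Arr C" "Dom C (shuf c d n) = opow C c n \<otimes> opow C d n"
    "Cod C (shuf c d n) = opow C (c \<otimes> d) n" "iso_arrow C (shuf c d n)"
  using assms by (induction n rule: induct_nat_012) auto

text \<open>The canonical map from \<open>I\<close> to its \<open>n\<close>-th power; each step
  beyond exponent 1 splits off a last factor \<open>I\<close>.\<close>

fun ushuf :: "nat \<Rightarrow> 'm" where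
  "ushuf 0 = Ident C (UnitO C)"
| "ushuf (Suc 0) = Ident C (UnitO C)"
| "ushuf (Suc (Suc n)) = (ushuf (Suc n) \<boxtimes> Ident C (UnitO C)) \<cdot> inv_arrow (LUnit C (UnitO C))"

lemma ushuf_simps [simp]:
  "ushuf n \<in> Arr C" "Dom C (ushuf n) = UnitO C" "Cod C (ushuf n) = opow C (UnitO C) n"
  "iso_arrow C (ushuf n)"
  by (induction n rule: induct_nat_012) auto

lemma wobj_wprod:
  "wobj C v (wprod w n) = lprod (TensO C) (UnitO C) (\<lambda>i. wobj C v (w i)) n"
  by (induction n rule: induct_nat_012) auto

lemma coherence_inv_arrow:
  "\<lbrakk>coherence C br v X Y f; iso_arrow C f\<rbrakk> \<Longrightarrow> coherence C br v Y X (inv_arrow f)"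
  by (rule coh_inverse[OF _ inverse_arrows_inv_arrow])

lemma coherence_interchange:
  assumes obj: "wobj C v X \<in> Obj C" "wobj C v X' \<in> Obj C" "wobj C v Y \<in> Obj C" "wobj C v Y' \<in> Obj C"
  shows "coherence C True v (Tens (Tens X X') (Tens Y Y')) (Tens (Tens X Y) (Tens X' Y'))
    (interchange (wobj C v X) (wobj C v X') (wobj C v Y) (wobj C v Y'))"
proof -
  have assoc: "coherence C True v (Tens (Tens X Y) Z) (Tens X (Tens Y Z))
      (Assoc C (wobj C v X) (wobj C v Y) (wobj C v Z))"
    and inv: "\<lbrakk>wobj C v X \<in> Obj C; wobj C v Y \<in> Obj C; wobj C v Z \<in> Obj C\<rbrakk> \<Longrightarrow>
      coherence C True v (Tens X (Tens Y Z)) (Tens (Tens X Y) Z)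
        (inv_arrow (Assoc C (wobj C v X) (wobj C v Y) (wobj C v Z)))" for X Y Z
    by (auto intro: coherence_inv_arrow coh_assoc)
  show ?thesis
    unfolding interchange_def
    by (rule coh_comp[OF inv[of X Y "Tens X' Y'", simplified] coh_comp[OF coh_tens[OF coh_ident
        coh_comp[OF assoc coh_comp[OF coh_tens[OF coh_braid coh_ident] inv]]]
        assoc[of X X' "Tens Y Y'", simplified]]]) (use obj in auto)
qed

text \<open>The recursion is a formal composite of coherence arrows between words, so the tensor
  axiom of a supply applies to \<open>shuf\<close>.\<close>

lemma shuffle_shuf:
  assumes "c \<in> Obj C" "d \<in> Obj C"
  shows "shuffle C c d n (shuf c d n)"
  unfolding shuffle_def
proof (induction n rule: induct_nat_012)
  case 0
  show ?case using coh_lunit[of C True "case_sum (\<lambda>_. c) (\<lambda>_. d)" One] by simp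
next
  case 1
  show ?case
    using coh_ident[of C True "case_sum (\<lambda>_. c) (\<lambda>_. d)" "Tens (Var (Inl 0)) (Var (Inr 0))"] by simp
next
  case (ge2 n)
  let ?v = "case_sum (\<lambda>_::nat. c) (\<lambda>_::nat. d)"
  have "wobj C ?v (wprod (\<lambda>i. Var (Inl i)) (Suc n)) = opow C c (Suc n)"
    "wobj C ?v (wprod (\<lambda>i. Var (Inr i)) (Suc n)) = opow C d (Suc n)"
    by (simp_all add: wobj_wprod opow_def)
  \<comment> \<open>Words of length \<open>Suc n\<close> use the indices up to \<open>n\<close>, so
    the pair to be appended has index \<open>Suc n\<close>.\<close>
  then show ?case
    using coh_comp[OF coh_tens[OF ge2(2) coh_ident[of C True ?v "Tens (Var (Inl (Suc n))) (Var (Inr (Suc n)))"]]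
      coherence_interchange[of ?v "wprod (\<lambda>i. Var (Inl i)) (Suc n)" "Var (Inl (Suc n))"
        "wprod (\<lambda>i. Var (Inr i)) (Suc n)" "Var (Inr (Suc n))"]] assms
    by simp
qed

lemma unit_shuffle_ushuf: "unit_shuffle C n (ushuf n)"
  unfolding unit_shuffle_def
proof (induction n rule: induct_nat_012)
  case 0
  show ?case using coh_ident[of C False "\<lambda>_. UnitO C" One] by simp
next
  case 1
  show ?case using coh_ident[of C False "\<lambda>_. UnitO C" One] by simp
next
  case (ge2 n)
  have "coherence C False (\<lambda>_::unit. UnitO C) One (Tens One One) (inv_arrow (LUnit C (UnitO C)))"
    using coherence_inv_arrow[OF coh_lunit[of C False "\<lambda>_. UnitO C" One]] by simp
  then show ?case
    using coh_comp[OF coh_tens[OF ge2(2) coh_ident[of C False "\<lambda>_. UnitO C" One]]] by simp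
qed

section \<open>Powers of coherence isomorphisms against shuffles\<close>

text \<open>In the induction step naturality of the interchange moves the shorter shuffles aside,
  the induction hypothesis handles the first factors, and \<open>interchange_assoc\<close> handles
  the last one.\<close>

lemma shuf_assoc:
  assumes obj: "a \<in> Obj C" "b \<in> Obj C" "c \<in> Obj C"
  shows "apow C (Assoc C a b c) n \<cdot> (shuf (a \<otimes> b) c n \<cdot> (shuf a b n \<boxtimes> Ident C (opow C c n)))
    = shuf a (b \<otimes> c) n \<cdot> ((Ident C (opow C a n) \<boxtimes> shuf b c n)
        \<cdot> Assoc C (opow C a n) (opow C b n) (opow C c n))"
proof (induction n rule: induct_nat_012)
  case 0
  \<comment> \<open>At exponent 0 the claim is the triangle at \<open>I\<close> with the right
    unitor of \<open>I\<close> replaced by the left one. These coincide because both transport to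
    identities.\<close>
  have "represents (Tens One One) One (LUnit C (UnitO C)) (\<lambda>z. Ident C z)"
    "represents (Tens One One) One (RUnit C (UnitO C)) (\<lambda>z. Ident C z)"
    using represents_lunit[of One] represents_runit[of One] by auto
  then have "LUnit C (UnitO C) = RUnit C (UnitO C)"
    by (rule represents_faithful) simp
  then show ?case using triangle[of "UnitO C" "UnitO C"] by simp
next
  case 1
  show ?case using obj by simp
next
  case (ge2 n)
  let ?a = "opow C a (Suc n)" and ?b = "opow C b (Suc n)" and ?c = "opow C c (Suc n)"
  let ?A = "Assoc C a b c" and ?B = "apow C (Assoc C a b c) (Suc n)"
  let ?s = "shuf (a \<otimes> b) c (Suc n)" and ?t = "shuf a b (Suc n)"
  let ?u = "shuf a (b \<otimes> c) (Suc n)" and ?w = "shuf b c (Suc n)"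
  have "apow C ?A (Suc (Suc n)) \<cdot> (shuf (a \<otimes> b) c (Suc (Suc n)) \<cdot> (shuf a b (Suc (Suc n)) \<boxtimes> Ident C (opow C c (Suc (Suc n)))))
      = ((?B \<cdot> ?s) \<boxtimes> ?A) \<cdot> ((interchange (opow C (a \<otimes> b) (Suc n)) (a \<otimes> b) ?c c
          \<cdot> ((?t \<boxtimes> Ident C (a \<otimes> b)) \<boxtimes> (Ident C ?c \<boxtimes> Ident C c)))
          \<cdot> (interchange ?a a ?b b \<boxtimes> Ident C (?c \<otimes> c)))"
    using obj by (simp add: merge)
  also have "\<dots> = ((?B \<cdot> ?s) \<boxtimes> ?A) \<cdot> ((((?t \<boxtimes> Ident C ?c) \<boxtimes> (Ident C (a \<otimes> b) \<boxtimes> Ident C c))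
          \<cdot> interchange (?a \<otimes> ?b) (a \<otimes> b) ?c c)
          \<cdot> (interchange ?a a ?b b \<boxtimes> Ident C (?c \<otimes> c)))"
    using obj by (subst interchange_natural) auto
  also have "\<dots> = ((?B \<cdot> (?s \<cdot> (?t \<boxtimes> Ident C ?c))) \<boxtimes> ?A)
          \<cdot> (interchange (?a \<otimes> ?b) (a \<otimes> b) ?c c \<cdot> (interchange ?a a ?b b \<boxtimes> Ident C (?c \<otimes> c)))"
    using obj by (simp add: merge)
  \<comment> \<open>The induction hypothesis trades the power of the associator for an associator of
    powers, which joins \<open>?A\<close> to form the left side of
    \<open>interchange_assoc\<close>.\<close>
  also have "\<dots> = ((?u \<cdot> (Ident C ?a \<boxtimes> ?w)) \<boxtimes> Ident C (a \<otimes> (b \<otimes> c))) \<cdot> ((Assoc C ?a ?b ?c \<boxtimes> ?A)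
          \<cdot> (interchange (?a \<otimes> ?b) (a \<otimes> b) ?c c \<cdot> (interchange ?a a ?b b \<boxtimes> Ident C (?c \<otimes> c))))"
    unfolding ge2(2) using obj by (simp add: merge)
  also have "\<dots> = ((?u \<cdot> (Ident C ?a \<boxtimes> ?w)) \<boxtimes> Ident C (a \<otimes> (b \<otimes> c))) \<cdot> (interchange ?a a (?b \<otimes> ?c) (b \<otimes> c) \<cdot>
      ((Ident C (?a \<otimes> a) \<boxtimes> interchange ?b b ?c c) \<cdot> Assoc C (?a \<otimes> a) (?b \<otimes> b) (?c \<otimes> c)))"
    using obj by (subst interchange_assoc) auto
  also have "\<dots> = (?u \<boxtimes> Ident C (a \<otimes> (b \<otimes> c)))
      \<cdot> ((((Ident C ?a \<boxtimes> ?w) \<boxtimes> (Ident C a \<boxtimes> Ident C (b \<otimes> c))) \<cdot> interchange ?a a (?b \<otimes> ?c) (b \<otimes> c)) \<cdot>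
      ((Ident C (?a \<otimes> a) \<boxtimes> interchange ?b b ?c c) \<cdot> Assoc C (?a \<otimes> a) (?b \<otimes> b) (?c \<otimes> c)))"
    using obj by (simp add: merge)
  also have "\<dots> = (?u \<boxtimes> Ident C (a \<otimes> (b \<otimes> c)))
      \<cdot> ((interchange ?a a (opow C (b \<otimes> c) (Suc n)) (b \<otimes> c) \<cdot> ((Ident C ?a \<boxtimes> Ident C a) \<boxtimes> (?w \<boxtimes> Ident C (b \<otimes> c)))) \<cdot>
      ((Ident C (?a \<otimes> a) \<boxtimes> interchange ?b b ?c c) \<cdot> Assoc C (?a \<otimes> a) (?b \<otimes> b) (?c \<otimes> c)))"
    using obj by (subst interchange_natural) auto
  also have "\<dots> = shuf a (b \<otimes> c) (Suc (Suc n)) \<cdot> ((Ident C (opow C a (Suc (Suc n))) \<boxtimes> shuf b c (Suc (Suc n)))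
        \<cdot> Assoc C (opow C a (Suc (Suc n))) (opow C b (Suc (Suc n))) (opow C c (Suc (Suc n))))"
    using obj by (simp add: merge)
  finally show ?case .
qed

text \<open>By induction: the hypothesis braids the first factors, and
  \<open>interchange_braid\<close> merges this with the braiding of the last pair.\<close>

lemma shuf_braid:
  assumes obj: "a \<in> Obj C" "b \<in> Obj C"
  shows "apow C (Braid C a b) n \<cdot> shuf a b n = shuf b a n \<cdot> Braid C (opow C a n) (opow C b n)"
proof (induction n rule: induct_nat_012)
  case 0
  \<comment> \<open>At exponent 0 the braiding of \<open>I\<close> with itself has to be the
    identity, which holds because swapping \<open>One\<close> past a word is trivial.\<close>
  have "represents (Tens One One) (Tens One One) (Braid C (UnitO C) (UnitO C)) (\<lambda>z. Ident C z)"
    using represents_cong[OF represents_braid[of One One], of "\<lambda>z. Ident C z"] swap_One_left[of One]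
    by auto
  then have "Braid C (UnitO C) (UnitO C) = Ident C (UnitO C \<otimes> UnitO C)"
    by (rule represents_faithful[OF _ represents_ident[of "Tens One One", simplified]]) simp_all
  then show ?case by simp
next
  case 1
  show ?case using obj by simp
next
  case (ge2 n)
  let ?a = "opow C a (Suc n)" and ?b = "opow C b (Suc n)"
  have "apow C (Braid C a b) (Suc (Suc n)) \<cdot> shuf a b (Suc (Suc n))
      = ((apow C (Braid C a b) (Suc n) \<cdot> shuf a b (Suc n)) \<boxtimes> Braid C a b) \<cdot> interchange ?a a ?b b"
    using obj by (simp add: merge)
  also have "\<dots> = (shuf b a (Suc n) \<boxtimes> Ident C (b \<otimes> a)) \<cdot> ((Braid C ?a ?b \<boxtimes> Braid C a b) \<cdot> interchange ?a a ?b b)"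
    unfolding ge2(2) using obj by (simp add: merge)
  also have "\<dots> = shuf b a (Suc (Suc n)) \<cdot> Braid C (opow C a (Suc (Suc n))) (opow C b (Suc (Suc n)))"
    using obj by (subst interchange_braid) auto
  finally show ?case .
qed

text \<open>The same induction, with \<open>interchange_lunit\<close> for the last factor.\<close>

lemma shuf_lunit:
  assumes obj: "a \<in> Obj C"
  shows "apow C (LUnit C a) n \<cdot> (shuf (UnitO C) a n \<cdot> (ushuf n \<boxtimes> Ident C (opow C a n))) = LUnit C (opow C a n)"
proof (induction n rule: induct_nat_012)
  case (ge2 n)
  let ?I = "UnitO C" and ?a = "opow C a (Suc n)"
  let ?s = "shuf ?I a (Suc n)" and ?u = "ushuf (Suc n)"
  have "apow C (LUnit C a) (Suc (Suc n)) \<cdot> (shuf ?I a (Suc (Suc n)) \<cdot> (ushuf (Suc (Suc n)) \<boxtimes> Ident C (opow C a (Suc (Suc n)))))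
      = ((apow C (LUnit C a) (Suc n) \<cdot> ?s) \<boxtimes> LUnit C a) \<cdot> ((interchange (opow C ?I (Suc n)) ?I ?a a
        \<cdot> ((?u \<boxtimes> Ident C ?I) \<boxtimes> (Ident C ?a \<boxtimes> Ident C a))) \<cdot> (inv_arrow (LUnit C ?I) \<boxtimes> Ident C (?a \<otimes> a)))"
    using obj by (simp add: merge)
  also have "\<dots> = ((apow C (LUnit C a) (Suc n) \<cdot> ?s) \<boxtimes> LUnit C a)
      \<cdot> ((((?u \<boxtimes> Ident C ?a) \<boxtimes> (Ident C ?I \<boxtimes> Ident C a)) \<cdot> interchange ?I ?I ?a a)
        \<cdot> (inv_arrow (LUnit C ?I) \<boxtimes> Ident C (?a \<otimes> a)))"
    using obj by (subst interchange_natural) auto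
  also have "\<dots> = ((apow C (LUnit C a) (Suc n) \<cdot> (?s \<cdot> (?u \<boxtimes> Ident C ?a))) \<boxtimes> LUnit C a)
      \<cdot> (interchange ?I ?I ?a a \<cdot> (inv_arrow (LUnit C ?I) \<boxtimes> Ident C (?a \<otimes> a)))"
    using obj by (simp add: merge)
  also have "\<dots> = LUnit C (opow C a (Suc (Suc n)))"
    unfolding ge2(2) using obj by (simp add: interchange_lunit)
  finally show ?case .
qed (use obj in auto)

text \<open>Swapping past \<open>One\<close> is trivial, so both sides transport to
  identities.\<close>

lemma runit_eq_lunit_braid:
  assumes "a \<in> Obj C"
  shows "RUnit C a = LUnit C a \<cdot> Braid C a (UnitO C)"
proof -
  have wf: "wf_word (Var a)" "wf_word One" using assms by auto
  show ?thesis
    by (rule represents_faithful[OF represents_runit[OF wf(1), simplified wobj.simps]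
        represents_comp[OF represents_braid[OF wf] represents_lunit[OF wf(1)], simplified wobj.simps]])
      (use assms in \<open>simp add: swap_One_right\<close>)
qed

end

section \<open>Homomorphisms of a supply\<close>

context supply_in
begin

lemma supply_arr [simp]:
  assumes "c \<in> Obj C" "\<mu> \<in> Hom P m n"
  shows "FArr (s c) \<mu> \<in> Arr C" "Dom C (FArr (s c) \<mu>) = opow C c m" "Cod C (FArr (s c) \<mu>) = opow C c n"
proof -
  interpret F: strong_monoidal_functor P C "s c" by (rule supply_functor[OF assms(1)])
  show "FArr (s c) \<mu> \<in> Arr C" "Dom C (FArr (s c) \<mu>) = opow C c m" "Cod C (FArr (s c) \<mu>) = opow C c n"
    using F.farr[OF assms(2)] supply_obj[OF assms(1)] by (auto simp: Hom_def)
qed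

text \<open>The tensor axiom at the recursive shuffles: up to the isomorphisms \<open>shuf\<close>,
  the supply on a product is the tensor product of the supplies.\<close>

lemma supply_shuf:
  "\<lbrakk>c \<in> Obj C; d \<in> Obj C; \<mu> \<in> Hom P m n\<rbrakk>
    \<Longrightarrow> FArr (s (c \<otimes>\<^bsub>C\<^esub> d)) \<mu> \<cdot>\<^bsub>C\<^esub> C.shuf c d m = C.shuf c d n \<cdot>\<^bsub>C\<^esub> (FArr (s c) \<mu> \<boxtimes>\<^bsub>C\<^esub> FArr (s d) \<mu>)"
  by (rule supply_tens[OF _ _ _ C.shuffle_shuf C.shuffle_shuf])

lemma supply_ushuf:
  "\<mu> \<in> Hom P m n \<Longrightarrow> FArr (s (UnitO C)) \<mu> \<cdot>\<^bsub>C\<^esub> C.ushuf m = C.ushuf n"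
  by (rule supply_unit[OF _ C.unit_shuffle_ushuf C.unit_shuffle_ushuf])

text \<open>The two commuting squares are pasted, since powers preserve composition. This serves the
  right unitor, a composite of a braiding and a left unitor.\<close>

lemma supply_homomorphism_comp:
  assumes f: "supply_homomorphism P C s f" and g: "supply_homomorphism P C s g" and "Dom C g = Cod C f"
  shows "supply_homomorphism P C s (g \<cdot>\<^bsub>C\<^esub> f)"
  unfolding supply_homomorphism_def
proof (intro conjI allI ballI)
  have arr: "f \<in> Arr C" "g \<in> Arr C" using f g by (auto simp: supply_homomorphism_def)
  then show "g \<cdot>\<^bsub>C\<^esub> f \<in> Arr C" using assms(3) by simp
  fix m n \<mu> assume \<mu>: "\<mu> \<in> Hom P m n"
  have "apow C (g \<cdot>\<^bsub>C\<^esub> f) n \<cdot>\<^bsub>C\<^esub> FArr (s (Dom C (g \<cdot>\<^bsub>C\<^esub> f))) \<mu>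
      = apow C g n \<cdot>\<^bsub>C\<^esub> (apow C f n \<cdot>\<^bsub>C\<^esub> FArr (s (Dom C f)) \<mu>)"
    using arr assms(3) \<mu> by (simp add: C.apow_comp)
  also have "\<dots> = (apow C g n \<cdot>\<^bsub>C\<^esub> FArr (s (Dom C g)) \<mu>) \<cdot>\<^bsub>C\<^esub> apow C f m"
    using f arr assms(3) \<mu> by (simp add: supply_homomorphism_def)
  also have "apow C g n \<cdot>\<^bsub>C\<^esub> FArr (s (Dom C g)) \<mu> = FArr (s (Cod C g)) \<mu> \<cdot>\<^bsub>C\<^esub> apow C g m"
    using g \<mu> by (simp add: supply_homomorphism_def)
  also have "\<dots> \<cdot>\<^bsub>C\<^esub> apow C f m = FArr (s (Cod C (g \<cdot>\<^bsub>C\<^esub> f))) \<mu> \<cdot>\<^bsub>C\<^esub> apow C (g \<cdot>\<^bsub>C\<^esub> f) m"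
    using arr assms(3) \<mu> by (simp add: C.apow_comp)
  finally show "apow C (g \<cdot>\<^bsub>C\<^esub> f) n \<cdot>\<^bsub>C\<^esub> FArr (s (Dom C (g \<cdot>\<^bsub>C\<^esub> f))) \<mu>
    = FArr (s (Cod C (g \<cdot>\<^bsub>C\<^esub> f))) \<mu> \<cdot>\<^bsub>C\<^esub> apow C (g \<cdot>\<^bsub>C\<^esub> f) m" .
qed

text \<open>Iterated shuffles turn the supply on either bracketing into a threefold tensor product,
  where naturality of the associator applies; \<open>shuf_assoc\<close> passes between the
  bracketings.\<close>

lemma supply_homomorphism_assoc:
  assumes obj: "a \<in> Obj C" "b \<in> Obj C" "c \<in> Obj C"
  shows "supply_homomorphism P C s (Assoc C a b c)"
  unfolding supply_homomorphism_def
proof (intro conjI allI ballI)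
  show "Assoc C a b c \<in> Arr C" using obj by simp
  fix m n \<mu> assume \<mu>: "\<mu> \<in> Hom P m n"
  let ?a = "FArr (s a) \<mu>" and ?b = "FArr (s b) \<mu>" and ?c = "FArr (s c) \<mu>"
  let ?ab = "FArr (s (a \<otimes>\<^bsub>C\<^esub> b)) \<mu>" and ?bc = "FArr (s (b \<otimes>\<^bsub>C\<^esub> c)) \<mu>"
  let ?l = "FArr (s (a \<otimes>\<^bsub>C\<^esub> b \<otimes>\<^bsub>C\<^esub> c)) \<mu>" and ?r = "FArr (s (a \<otimes>\<^bsub>C\<^esub> (b \<otimes>\<^bsub>C\<^esub> c))) \<mu>"
  \<comment> \<open>\<open>?X\<close> and \<open>?Y\<close> are the iterated shuffles for the two
    bracketings, and \<open>?A\<close> is the associator of the powers.\<close>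
  let ?X = "\<lambda>n. C.shuf (a \<otimes>\<^bsub>C\<^esub> b) c n \<cdot>\<^bsub>C\<^esub> (C.shuf a b n \<boxtimes>\<^bsub>C\<^esub> Ident C (opow C c n))"
  let ?Y = "\<lambda>n. C.shuf a (b \<otimes>\<^bsub>C\<^esub> c) n \<cdot>\<^bsub>C\<^esub> (Ident C (opow C a n) \<boxtimes>\<^bsub>C\<^esub> C.shuf b c n)"
  let ?A = "\<lambda>n. Assoc C (opow C a n) (opow C b n) (opow C c n)"
  note merge = C.merge
  have "?l \<cdot>\<^bsub>C\<^esub> ?X m = (?l \<cdot>\<^bsub>C\<^esub> C.shuf (a \<otimes>\<^bsub>C\<^esub> b) c m) \<cdot>\<^bsub>C\<^esub> (C.shuf a b m \<boxtimes>\<^bsub>C\<^esub> Ident C (opow C c m))"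
    using obj \<mu> by simp
  also have "\<dots> = C.shuf (a \<otimes>\<^bsub>C\<^esub> b) c n \<cdot>\<^bsub>C\<^esub> ((?ab \<cdot>\<^bsub>C\<^esub> C.shuf a b m) \<boxtimes>\<^bsub>C\<^esub> ?c)"
    using obj \<mu> by (simp add: supply_shuf[OF _ obj(3) \<mu>] merge)
  also have "\<dots> = ?X n \<cdot>\<^bsub>C\<^esub> ((?a \<boxtimes>\<^bsub>C\<^esub> ?b) \<boxtimes>\<^bsub>C\<^esub> ?c)"
    unfolding supply_shuf[OF obj(1,2) \<mu>] using obj \<mu> by (simp add: merge)
  finally have X: "?l \<cdot>\<^bsub>C\<^esub> ?X m = ?X n \<cdot>\<^bsub>C\<^esub> ((?a \<boxtimes>\<^bsub>C\<^esub> ?b) \<boxtimes>\<^bsub>C\<^esub> ?c)" .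
  have "?r \<cdot>\<^bsub>C\<^esub> ?Y m = (?r \<cdot>\<^bsub>C\<^esub> C.shuf a (b \<otimes>\<^bsub>C\<^esub> c) m) \<cdot>\<^bsub>C\<^esub> (Ident C (opow C a m) \<boxtimes>\<^bsub>C\<^esub> C.shuf b c m)"
    using obj \<mu> by simp
  also have "\<dots> = C.shuf a (b \<otimes>\<^bsub>C\<^esub> c) n \<cdot>\<^bsub>C\<^esub> (?a \<boxtimes>\<^bsub>C\<^esub> (?bc \<cdot>\<^bsub>C\<^esub> C.shuf b c m))"
    using obj \<mu> by (simp add: supply_shuf[OF obj(1) _ \<mu>] merge)
  also have "\<dots> = ?Y n \<cdot>\<^bsub>C\<^esub> (?a \<boxtimes>\<^bsub>C\<^esub> (?b \<boxtimes>\<^bsub>C\<^esub> ?c))"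
    unfolding supply_shuf[OF obj(2,3) \<mu>] using obj \<mu> by (simp add: merge)
  finally have Y: "?r \<cdot>\<^bsub>C\<^esub> ?Y m = ?Y n \<cdot>\<^bsub>C\<^esub> (?a \<boxtimes>\<^bsub>C\<^esub> (?b \<boxtimes>\<^bsub>C\<^esub> ?c))" .
  have A: "apow C (Assoc C a b c) k \<cdot>\<^bsub>C\<^esub> ?X k = ?Y k \<cdot>\<^bsub>C\<^esub> ?A k" for k
    using C.shuf_assoc[OF obj] obj by simp
  have "apow C (Assoc C a b c) n \<cdot>\<^bsub>C\<^esub> ?l = ?r \<cdot>\<^bsub>C\<^esub> apow C (Assoc C a b c) m"
  proof (rule C.iso_cancel_right[of "?X m"])
    have "(apow C (Assoc C a b c) n \<cdot>\<^bsub>C\<^esub> ?l) \<cdot>\<^bsub>C\<^esub> ?X m = apow C (Assoc C a b c) n \<cdot>\<^bsub>C\<^esub> (?l \<cdot>\<^bsub>C\<^esub> ?X m)"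
      using obj \<mu> by simp
    also have "\<dots> = (apow C (Assoc C a b c) n \<cdot>\<^bsub>C\<^esub> ?X n) \<cdot>\<^bsub>C\<^esub> ((?a \<boxtimes>\<^bsub>C\<^esub> ?b) \<boxtimes>\<^bsub>C\<^esub> ?c)"
      unfolding X using obj \<mu> by simp
    also have "\<dots> = ?Y n \<cdot>\<^bsub>C\<^esub> (?A n \<cdot>\<^bsub>C\<^esub> ((?a \<boxtimes>\<^bsub>C\<^esub> ?b) \<boxtimes>\<^bsub>C\<^esub> ?c))"
      unfolding A using obj \<mu> by simp
    also have "\<dots> = (?Y n \<cdot>\<^bsub>C\<^esub> (?a \<boxtimes>\<^bsub>C\<^esub> (?b \<boxtimes>\<^bsub>C\<^esub> ?c))) \<cdot>\<^bsub>C\<^esub> ?A m"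
      using obj \<mu> by (subst C.assoc_nat) auto
    also have "\<dots> = ?r \<cdot>\<^bsub>C\<^esub> (?Y m \<cdot>\<^bsub>C\<^esub> ?A m)"
      unfolding Y[symmetric] using obj \<mu> by simp
    also have "\<dots> = (?r \<cdot>\<^bsub>C\<^esub> apow C (Assoc C a b c) m) \<cdot>\<^bsub>C\<^esub> ?X m"
      unfolding A[symmetric] using obj \<mu> by simp
    finally show "(apow C (Assoc C a b c) n \<cdot>\<^bsub>C\<^esub> ?l) \<cdot>\<^bsub>C\<^esub> ?X m
      = (?r \<cdot>\<^bsub>C\<^esub> apow C (Assoc C a b c) m) \<cdot>\<^bsub>C\<^esub> ?X m" .
  qed (use obj \<mu> in auto)
  then show "apow C (Assoc C a b c) n \<cdot>\<^bsub>C\<^esub> FArr (s (Dom C (Assoc C a b c))) \<mu>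
    = FArr (s (Cod C (Assoc C a b c))) \<mu> \<cdot>\<^bsub>C\<^esub> apow C (Assoc C a b c) m"
    using obj by simp
qed

text \<open>The unit axiom lets \<open>ushuf\<close> absorb the supply on \<open>I\<close>, leaving
  an identity on \<open>I\<close> beside \<open>?a\<close>; naturality of the left unitor then
  applies.\<close>

lemma supply_homomorphism_lunit:
  assumes obj: "a \<in> Obj C"
  shows "supply_homomorphism P C s (LUnit C a)"
  unfolding supply_homomorphism_def
proof (intro conjI allI ballI)
  show "LUnit C a \<in> Arr C" using obj by simp
  fix m n \<mu> assume \<mu>: "\<mu> \<in> Hom P m n"
  let ?I = "UnitO C"
  let ?a = "FArr (s a) \<mu>" and ?i = "FArr (s ?I) \<mu>" and ?l = "FArr (s (?I \<otimes>\<^bsub>C\<^esub> a)) \<mu>"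
  let ?X = "\<lambda>n. C.shuf ?I a n \<cdot>\<^bsub>C\<^esub> (C.ushuf n \<boxtimes>\<^bsub>C\<^esub> Ident C (opow C a n))"
  have "?l \<cdot>\<^bsub>C\<^esub> ?X m = (?l \<cdot>\<^bsub>C\<^esub> C.shuf ?I a m) \<cdot>\<^bsub>C\<^esub> (C.ushuf m \<boxtimes>\<^bsub>C\<^esub> Ident C (opow C a m))"
    using obj \<mu> by simp
  also have "\<dots> = C.shuf ?I a n \<cdot>\<^bsub>C\<^esub> ((?i \<cdot>\<^bsub>C\<^esub> C.ushuf m) \<boxtimes>\<^bsub>C\<^esub> ?a)"
    using obj \<mu> by (simp add: supply_shuf[OF _ obj \<mu>] C.merge)
  also have "\<dots> = ?X n \<cdot>\<^bsub>C\<^esub> (Ident C ?I \<boxtimes>\<^bsub>C\<^esub> ?a)"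
    unfolding supply_ushuf[OF \<mu>] using obj \<mu> by (simp add: C.merge)
  finally have X: "?l \<cdot>\<^bsub>C\<^esub> ?X m = ?X n \<cdot>\<^bsub>C\<^esub> (Ident C ?I \<boxtimes>\<^bsub>C\<^esub> ?a)" .
  have "apow C (LUnit C a) n \<cdot>\<^bsub>C\<^esub> ?l = ?a \<cdot>\<^bsub>C\<^esub> apow C (LUnit C a) m"
  proof (rule C.iso_cancel_right[of "?X m"])
    have "(apow C (LUnit C a) n \<cdot>\<^bsub>C\<^esub> ?l) \<cdot>\<^bsub>C\<^esub> ?X m = apow C (LUnit C a) n \<cdot>\<^bsub>C\<^esub> (?l \<cdot>\<^bsub>C\<^esub> ?X m)"
      using obj \<mu> by simp
    also have "\<dots> = (apow C (LUnit C a) n \<cdot>\<^bsub>C\<^esub> ?X n) \<cdot>\<^bsub>C\<^esub> (Ident C ?I \<boxtimes>\<^bsub>C\<^esub> ?a)"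
      unfolding X using obj \<mu> by simp
    also have "\<dots> = ?a \<cdot>\<^bsub>C\<^esub> LUnit C (opow C a m)"
      unfolding C.shuf_lunit[OF obj] using obj \<mu> by (subst C.lunit_nat) auto
    also have "\<dots> = (?a \<cdot>\<^bsub>C\<^esub> apow C (LUnit C a) m) \<cdot>\<^bsub>C\<^esub> ?X m"
      unfolding C.shuf_lunit[OF obj, symmetric] using obj \<mu> by simp
    finally show "(apow C (LUnit C a) n \<cdot>\<^bsub>C\<^esub> ?l) \<cdot>\<^bsub>C\<^esub> ?X m = (?a \<cdot>\<^bsub>C\<^esub> apow C (LUnit C a) m) \<cdot>\<^bsub>C\<^esub> ?X m" .
  qed (use obj \<mu> in auto)
  then show "apow C (LUnit C a) n \<cdot>\<^bsub>C\<^esub> FArr (s (Dom C (LUnit C a))) \<mu>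
    = FArr (s (Cod C (LUnit C a))) \<mu> \<cdot>\<^bsub>C\<^esub> apow C (LUnit C a) m"
    using obj by simp
qed

text \<open>After precomposing with a shuffle, \<open>shuf_braid\<close> replaces the power of the
  braiding by the braiding of powers, which is natural.\<close>

lemma supply_homomorphism_braid:
  assumes obj: "a \<in> Obj C" "b \<in> Obj C"
  shows "supply_homomorphism P C s (Braid C a b)"
  unfolding supply_homomorphism_def
proof (intro conjI allI ballI)
  show "Braid C a b \<in> Arr C" using obj by simp
  fix m n \<mu> assume \<mu>: "\<mu> \<in> Hom P m n"
  let ?a = "FArr (s a) \<mu>" and ?b = "FArr (s b) \<mu>"
  let ?ab = "FArr (s (a \<otimes>\<^bsub>C\<^esub> b)) \<mu>" and ?ba = "FArr (s (b \<otimes>\<^bsub>C\<^esub> a)) \<mu>"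
  let ?B = "\<lambda>n. apow C (Braid C a b) n"
  have "?B n \<cdot>\<^bsub>C\<^esub> ?ab = ?ba \<cdot>\<^bsub>C\<^esub> ?B m"
  proof (rule C.iso_cancel_right[of "C.shuf a b m"])
    have "(?B n \<cdot>\<^bsub>C\<^esub> ?ab) \<cdot>\<^bsub>C\<^esub> C.shuf a b m = (?B n \<cdot>\<^bsub>C\<^esub> C.shuf a b n) \<cdot>\<^bsub>C\<^esub> (?a \<boxtimes>\<^bsub>C\<^esub> ?b)"
      using obj \<mu> by (simp add: supply_shuf)
    also have "\<dots> = C.shuf b a n \<cdot>\<^bsub>C\<^esub> (Braid C (opow C a n) (opow C b n) \<cdot>\<^bsub>C\<^esub> (?a \<boxtimes>\<^bsub>C\<^esub> ?b))"
      unfolding C.shuf_braid[OF obj] using obj \<mu> by simp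
    also have "\<dots> = (C.shuf b a n \<cdot>\<^bsub>C\<^esub> (?b \<boxtimes>\<^bsub>C\<^esub> ?a)) \<cdot>\<^bsub>C\<^esub> Braid C (opow C a m) (opow C b m)"
      using obj \<mu> by (subst C.braid_nat) auto
    also have "\<dots> = ?ba \<cdot>\<^bsub>C\<^esub> (C.shuf b a m \<cdot>\<^bsub>C\<^esub> Braid C (opow C a m) (opow C b m))"
      unfolding supply_shuf[OF obj(2,1) \<mu>, symmetric] using obj \<mu> by simp
    also have "\<dots> = (?ba \<cdot>\<^bsub>C\<^esub> ?B m) \<cdot>\<^bsub>C\<^esub> C.shuf a b m"
      unfolding C.shuf_braid[OF obj, symmetric] using obj \<mu> by simp
    finally show "(?B n \<cdot>\<^bsub>C\<^esub> ?ab) \<cdot>\<^bsub>C\<^esub> C.shuf a b m = (?ba \<cdot>\<^bsub>C\<^esub> ?B m) \<cdot>\<^bsub>C\<^esub> C.shuf a b m" .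
  qed (use obj \<mu> in auto)
  then show "apow C (Braid C a b) n \<cdot>\<^bsub>C\<^esub> FArr (s (Dom C (Braid C a b))) \<mu>
    = FArr (s (Cod C (Braid C a b))) \<mu> \<cdot>\<^bsub>C\<^esub> apow C (Braid C a b) m"
    using obj by simp
qed

lemma supply_homomorphism_runit:
  assumes "a \<in> Obj C"
  shows "supply_homomorphism P C s (RUnit C a)"
  unfolding C.runit_eq_lunit_braid[OF assms]
  by (intro supply_homomorphism_comp supply_homomorphism_braid supply_homomorphism_lunit)
    (use assms in auto)

end

theorem theorem3p15:
  fixes P :: "(nat, 'p) smc"
    and C :: "('o, 'm) smc"
    and s :: "'o \<Rightarrow> (nat, 'p, 'o, 'm) monfun"
  assumes "prop_category P"
    and "symmetric_monoidal_category C"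
    and "supply_in P C s"
  shows "(\<forall>a \<in> Obj C. \<forall>b \<in> Obj C. \<forall>c \<in> Obj C. supply_homomorphism P C s (Assoc C a b c))
    \<and> (\<forall>a \<in> Obj C. supply_homomorphism P C s (LUnit C a))
    \<and> (\<forall>a \<in> Obj C. supply_homomorphism P C s (RUnit C a))
    \<and> (\<forall>a \<in> Obj C. \<forall>b \<in> Obj C. supply_homomorphism P C s (Braid C a b))"
  using assms(3) by (simp add: supply_in.supply_homomorphism_assoc supply_in.supply_homomorphism_lunit
      supply_in.supply_homomorphism_runit supply_in.supply_homomorphism_braid)

end
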